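(* Let $F$ denote a self-similar set associated with the iterated function system $\Phi=\{\phi_1,\dots,\phi_N\}$ acting on $X$. Assume that $\Phi$ satisfies the open set condition with feasible open set $\operatorname{int}X$ and that $\lambda^1(F)=0$. Let $r_1,\dots,r_N$ denote the respective similarity ratios of $\phi_1,\dots,\phi_N$ and let $\delta$ denote the Minkowski dimension of $F$. Then the following hold. (i) The average Minkowski content of $F$ exists and is given by $$\widetilde{\mathcal M}(F)=\frac{2^{1-\delta}\sum_{i=1}^{Q-1}|L^i|^\delta}{(\delta-1)\delta\sum_{i\in\Sigma}\ln(r_i)r_i^\delta}.$$ (ii) If $\Phi$ is nonlattice, then the Minkowski content $\mathcal M(F)$ exists and is equal to $\widetilde{\mathcal M}(F)$. (iii) If $\Phi$ is lattice, then $$0<\underline{\mathcal M}(F)<\overline{\mathcal M}(F)<\infty.$$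
   Context: **Iterated function systems.** $X\subset\mathbb R$ is a nonempty compact interval, $N\ge2$, and $\phi_1,\dots,\phi_N\colon X\to X$ are similarities with similarity ratios $r_i=|\phi_i'|\in(0,1)$; $\Sigma=\{1,\dots,N\}$. The self-similar set $F$ associated with $\Phi$ is the unique nonempty compact set with $F=\bigcup_i\phi_i(F)$. $\Phi$ satisfies the open set condition with feasible open set $O$ if $O\subset\mathbb R$ is nonempty, open and bounded, $\bigcup_i\phi_i(O)\subseteq O$ and $\phi_i(O)\cap\phi_j(O)=\emptyset$ for $i\ne j$. **Gaps.** The primary gaps $L^1,\dots,L^{Q-1}$ of $F$ are the gap intervals obtained by applying $\Phi$ to the convex hull $\langle F\rangle$ of $F$ (the connected components of $\langle F\rangle\setminus\bigcup_i\phi_i\langle F\rangle$); $2\le Q\le N$ as $\lambda^1(F)=0$. $|\cdot|$ denotes length. **Lattice property.** Let $\Sigma^\infty$ be the set of infinite words over $\Sigma$ with the topology of pointwise convergence, with left shift $\sigma$. The geometric potential function is $\xi(\omega)=-\ln r_{\omega_1}$, $\omega=\omega_1\omega_2\cdots\in\Sigma^\infty$. $\Phi$ is lattice if there are continuous $\zeta,\psi\colon\Sigma^\infty\to\mathbb R$ with $\xi-\zeta=\psi-\psi\circ\sigma$ and the range of $\zeta$ contained in a discrete subgroup of $\mathbb R$; otherwise $\Phi$ is nonlattice. **Minkowski content.** $\lambda^1$ is Lebesgue measure and $Y_\varepsilon=\{x\in\mathbb R:\inf_{y\in Y}|x-y|\le\varepsilon\}$. The Minkowski dimension of $F$, $\delta=1-\lim_{\varepsilon\searrow0}\ln\lambda^1(F_\varepsilon)/\ln\varepsilon$,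 exists. $\overline{\mathcal M}(F)$ and $\underline{\mathcal M}(F)$ are the $\limsup$ and $\liminf$ of $\varepsilon^{\delta-1}\lambda^1(F_\varepsilon)$ as $\varepsilon\to0$; if they coincide, the common value $\mathcal M(F)$ is the Minkowski content (said to exist in this case). The average Minkowski content is $\widetilde{\mathcal M}(F)=\lim_{T\searrow0}|\ln T|^{-1}\int_T^1\varepsilon^{\delta-2}\lambda^1(F_\varepsilon)\,d\varepsilon$ if this limit exists. *)

theory Defs
  imports "HOL-Analysis.Analysis"
begin

section \<open>Iterated function systems of similarities on an interval\<close>

definition similarity_on :: "real set \<Rightarrow> real \<Rightarrow> (real \<Rightarrow> real) \<Rightarrow> bool" where
  "similarity_on X c f \<longleftrightarrow> (\<forall>x\<in>X. \<forall>y\<in>X. dist (f x) (f y) = c * dist x y)"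

text \<open>The alphabet is \<open>{1..N}\<close>. The maps are only constrained on \<open>X\<close>.\<close>

definition similarity_ifs ::
  "real set \<Rightarrow> nat \<Rightarrow> (nat \<Rightarrow> real \<Rightarrow> real) \<Rightarrow> (nat \<Rightarrow> real) \<Rightarrow> bool" where
  "similarity_ifs X N \<phi> r \<longleftrightarrow>
     X \<noteq> {} \<and> compact X \<and> is_interval X \<and> 2 \<le> N \<and>
     (\<forall>i\<in>{1..N}. \<phi> i ` X \<subseteq> X \<and> 0 < r i \<and> r i < 1 \<and> similarity_on X (r i) (\<phi> i))"

definition self_similar_set ::
  "real set \<Rightarrow> nat \<Rightarrow> (nat \<Rightarrow> real \<Rightarrow> real) \<Rightarrow> real set \<Rightarrow> bool" where
  "self_similar_set X N \<phi> F \<longleftrightarrow>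
     F \<subseteq> X \<and> F \<noteq> {} \<and> compact F \<and> F = (\<Union>i\<in>{1..N}. \<phi> i ` F)"

definition feasible_open_set ::
  "nat \<Rightarrow> (nat \<Rightarrow> real \<Rightarrow> real) \<Rightarrow> real set \<Rightarrow> bool" where
  "feasible_open_set N \<phi> U \<longleftrightarrow>
     U \<noteq> {} \<and> open U \<and> bounded U \<and> (\<Union>i\<in>{1..N}. \<phi> i ` U) \<subseteq> U \<and>
     (\<forall>i\<in>{1..N}. \<forall>j\<in>{1..N}. i \<noteq> j \<longrightarrow> \<phi> i ` U \<inter> \<phi> j ` U = {})"

text \<open>The intervals \<open>L\<^sup>1, \<dots>, L\<^sup>Q\<^sup>-\<^sup>1\<close>. As \<open>\<langle>F\<rangle>\<close> minus \<open>N\<close> intervals has finitely many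
  components, a sum over \<open>i = 1, \<dots>, Q - 1\<close> is a (finite) sum over this set.\<close>

definition primary_gaps ::
  "nat \<Rightarrow> (nat \<Rightarrow> real \<Rightarrow> real) \<Rightarrow> real set \<Rightarrow> real set set" where
  "primary_gaps N \<phi> F =
     components (convex hull F - (\<Union>i\<in>{1..N}. \<phi> i ` (convex hull F)))"


section \<open>Lattice and nonlattice systems\<close>

text \<open>A word \<open>\<omega>\<^sub>1\<omega>\<^sub>2\<dots>\<close> is represented by the function \<open>\<omega>\<close> with
  \<open>\<omega> n = \<omega>\<^sub>n\<^sub>+\<^sub>1\<close>. The topology on the function type is the product topology
  of the discrete topology on the naturals, i.e. that of pointwise convergence.\<close>

definition words :: "nat \<Rightarrow> (nat \<Rightarrow> nat) set" where
  "words N = {\<omega>. \<forall>n. \<omega> n \<in> {1..N}}"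

definition shift :: "(nat \<Rightarrow> nat) \<Rightarrow> (nat \<Rightarrow> nat)" where
  "shift \<omega> = (\<lambda>n. \<omega> (Suc n))"

definition geometric_potential :: "(nat \<Rightarrow> real) \<Rightarrow> (nat \<Rightarrow> nat) \<Rightarrow> real" where
  "geometric_potential r \<omega> = - ln (r (\<omega> 0))"

definition discrete_subgroup :: "real set \<Rightarrow> bool" where
  "discrete_subgroup G \<longleftrightarrow>
     0 \<in> G \<and> (\<forall>x\<in>G. \<forall>y\<in>G. x - y \<in> G) \<and> discrete G"

definition lattice_ifs :: "nat \<Rightarrow> (nat \<Rightarrow> real) \<Rightarrow> bool" where
  "lattice_ifs N r \<longleftrightarrow>
     (\<exists>(\<zeta> :: (nat \<Rightarrow> nat) \<Rightarrow> real) (\<psi> :: (nat \<Rightarrow> nat) \<Rightarrow> real) G.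
        continuous_on (words N) \<zeta> \<and> continuous_on (words N) \<psi> \<and>
        (\<forall>\<omega>\<in>words N. geometric_potential r \<omega> - \<zeta> \<omega> = \<psi> \<omega> - \<psi> (shift \<omega>)) \<and>
        discrete_subgroup G \<and> \<zeta> ` words N \<subseteq> G)"


section \<open>Minkowski dimension and Minkowski content\<close>

text \<open>\<open>infdist\<close> is the infimum of the distances for nonempty sets only (for the empty set
  it is \<open>0\<close>); below it is applied to nonempty compact sets.\<close>

definition parallel_set :: "real set \<Rightarrow> real \<Rightarrow> real set" where
  "parallel_set Y \<epsilon> = {x. infdist x Y \<le> \<epsilon>}"

definition parallel_volume :: "real set \<Rightarrow> real \<Rightarrow> real" where
  "parallel_volume Y \<epsilon> = measure lborel (parallel_set Y \<epsilon>)"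

text \<open>\<open>Lim\<close> and, below, \<open>THE\<close> are meaningful only if the limit in question exists; for the
  dimension of self-similar sets it does.\<close>

definition minkowski_dim :: "real set \<Rightarrow> real" where
  "minkowski_dim Y = 1 - Lim (at_right 0) (\<lambda>\<epsilon>. ln (parallel_volume Y \<epsilon>) / ln \<epsilon>)"

definition upper_minkowski_content :: "real set \<Rightarrow> ereal" where
  "upper_minkowski_content Y =
     Limsup (at_right 0) (\<lambda>\<epsilon>. ereal (\<epsilon> powr (minkowski_dim Y - 1) * parallel_volume Y \<epsilon>))"

definition lower_minkowski_content :: "real set \<Rightarrow> ereal" where
  "lower_minkowski_content Y =
     Liminf (at_right 0) (\<lambda>\<epsilon>. ereal (\<epsilon> powr (minkowski_dim Y - 1) * parallel_volume Y \<epsilon>))"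

definition has_minkowski_content :: "real set \<Rightarrow> ereal \<Rightarrow> bool" where
  "has_minkowski_content Y m \<longleftrightarrow>
     lower_minkowski_content Y = m \<and> upper_minkowski_content Y = m"

definition has_average_minkowski_content :: "real set \<Rightarrow> real \<Rightarrow> bool" where
  "has_average_minkowski_content Y m \<longleftrightarrow>
     ((\<lambda>T. inverse \<bar>ln T\<bar> *
        integral {T..1} (\<lambda>\<epsilon>. \<epsilon> powr (minkowski_dim Y - 2) * parallel_volume Y \<epsilon>))
      \<longlongrightarrow> m) (at_right 0)"

definition average_minkowski_content :: "real set \<Rightarrow> real" where
  "average_minkowski_content Y = (THE m. has_average_minkowski_content Y m)"

end

theory Submission
  imports Defs
begin

text \<open>
  Put \<open>\<langle>F\<rangle> = [c, d]\<close> and let \<open>V \<epsilon>\<close> be the length of the part of the \<open>\<epsilon>\<close>-parallel set inside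
  \<open>[c, d]\<close>, so that \<open>\<lambda>(F\<^sub>\<epsilon>) = 2 \<epsilon> + V \<epsilon>\<close>. Splitting \<open>[c, d]\<close> into the pieces \<open>\<phi>\<^sub>i [c, d]\<close> and the
  primary gaps gives \<open>V \<epsilon> = \<Sum> r\<^sub>i V (\<epsilon> / r\<^sub>i) + \<Sum> min |L| (2 \<epsilon>)\<close>. For the exponent \<open>\<delta>\<close> with
  \<open>\<Sum> r\<^sub>i\<^sup>\<delta> = 1\<close>, the function \<open>f t = \<epsilon>\<^sup>\<delta>\<^sup>-\<^sup>1 V \<epsilon>\<close>, \<open>\<epsilon> = exp (- t)\<close>, solves the renewal equation
  \<open>f t = \<Sum> p\<^sub>i f (t - s\<^sub>i) + z t\<close> with \<open>p\<^sub>i = r\<^sub>i\<^sup>\<delta>\<close> and \<open>s\<^sub>i = - ln r\<^sub>i\<close>, and it stays between two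
  positive constants, so \<open>\<delta>\<close> is the Minkowski dimension. If \<open>B' = f\<close>, then
  \<open>\<Sum> p\<^sub>i (B t - B (t - s\<^sub>i))\<close> is a primitive of \<open>z\<close> and converges to an explicit \<open>I\<close>. This yields
  \<open>B t / t \<longlonglongrightarrow> I / \<Sum> p\<^sub>i s\<^sub>i\<close>, which is the average content; in the nonlattice case also \<open>f\<close> itself
  converges to this value. In the lattice case the lengths of all gaps avoid some scaled family of
  intervals on which \<open>V\<close> is then affine, whereas \<open>\<epsilon>\<^sup>1\<^sup>-\<^sup>\<delta>\<close> is strictly concave: \<open>f\<close> cannot converge.
\<close>


section \<open>Lattices and semigroups of reals\<close>

text \<open>Applied to the steps of a renewal equation, these are the time lags reached by iterating
  the equation backwards.\<close>

inductive_set semigroup_hull :: "real set \<Rightarrow> real set" for S :: "real set" where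
  zero: "0 \<in> semigroup_hull S"
| step: "x \<in> semigroup_hull S \<Longrightarrow> s \<in> S \<Longrightarrow> x + s \<in> semigroup_hull S"

lemma semigroup_add:
  assumes "x \<in> semigroup_hull S" "y \<in> semigroup_hull S"
  shows "x + y \<in> semigroup_hull S"
  using assms(2)
proof induction
  case zero
  then show ?case using assms(1) by simp
next
  case (step y s)
  then show ?case
    using semigroup_hull.step[of "x + y" S s] by (simp add: add.assoc)
qed

lemma semigroup_mult:
  assumes "x \<in> semigroup_hull S"
  shows "real n * x \<in> semigroup_hull S"
proof (induction n)
  case 0
  then show ?case by (simp add: semigroup_hull.zero)
next
  case (Suc n)
  then show ?case using semigroup_add[OF Suc assms] by (simp add: algebra_simps)
qed

text \<open>The group generated by \<open>S\<close> consists of differences of semigroup elements. A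
  small group element is thus a small difference \<open>u - v\<close> of two lags, which is the form
  the renewal theorem uses.\<close>

lemma semigroup_differences_subgroup:
  fixes S :: "real set"
  defines "G \<equiv> {u - v |u v. u \<in> semigroup_hull S \<and> v \<in> semigroup_hull S}"
  shows "0 \<in> G" and "\<And>x y. x \<in> G \<Longrightarrow> y \<in> G \<Longrightarrow> x - y \<in> G" and "S \<subseteq> G"
proof -
  show "0 \<in> G"
    unfolding G_def using semigroup_hull.zero by force
  show "x - y \<in> G" if xy: "x \<in> G" "y \<in> G" for x y
  proof -
    obtain a b where x: "x = a - b" "a \<in> semigroup_hull S" "b \<in> semigroup_hull S"
      using xy(1) unfolding G_def by blast
    obtain c d where y: "y = c - d" "c \<in> semigroup_hull S" "d \<in> semigroup_hull S"
      using xy(2) unfolding G_def by blast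
    have "x - y = (a + d) - (b + c)" using x y by simp
    then show ?thesis
      unfolding G_def using x y semigroup_add by blast
  qed
  show "S \<subseteq> G"
  proof
    fix s assume "s \<in> S"
    then have "0 + s \<in> semigroup_hull S" by (intro semigroup_hull.intros)
    then show "s \<in> G" unfolding G_def using semigroup_hull.zero by force
  qed
qed

section \<open>Discrete subgroups of the reals\<close>

lemma discrete_subgroupI:
  assumes "0 \<in> G" "\<And>x y. x \<in> G \<Longrightarrow> y \<in> G \<Longrightarrow> x - y \<in> G"
    and "e > 0" "\<And>x. x \<in> G \<Longrightarrow> \<bar>x\<bar> < e \<Longrightarrow> x = 0"
  shows "discrete_subgroup G"
proof -
  have "x isolated_in G" if "x \<in> G" for x
    unfolding isolated_in_dist_Ex_iff
  proof (intro conjI exI ballI impI)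
    fix y assume "y \<in> G" "dist x y < e"
    then show "y = x" using assms(4)[of "x - y"] assms(2) that by (auto simp: dist_real_def)
  qed (use assms that in auto)
  then show ?thesis
    unfolding discrete_subgroup_def using assms by (auto intro: discreteI)
qed

text \<open>A discrete group with a positive element has a least positive element \<open>a\<close>;
  division with remainder then shows that every element is an integer multiple of
  \<open>a\<close>.\<close>

lemma discrete_subgroup_cyclic:
  assumes "discrete_subgroup G" "x0 \<in> G" "x0 > 0"
  obtains a where "a > 0" "\<And>x. x \<in> G \<Longrightarrow> \<exists>k::int. x = of_int k * a"
proof -
  have zero: "0 \<in> G" and sub: "\<And>x y. x \<in> G \<Longrightarrow> y \<in> G \<Longrightarrow> x - y \<in> G"
    using assms(1) by (auto simp: discrete_subgroup_def)
  have "0 isolated_in G"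
    using assms(1) zero by (auto simp: discrete_subgroup_def dest: discreteD)
  then obtain e where e: "e > 0" "\<And>y. y \<in> G \<Longrightarrow> \<bar>y\<bar> < e \<Longrightarrow> y = 0"
    unfolding isolated_in_dist_Ex_iff by auto
  have neg: "- x \<in> G" if "x \<in> G" for x
    using sub[OF zero that] by simp
  have add: "x + y \<in> G" if "x \<in> G" "y \<in> G" for x y
    using sub[OF that(1) neg[OF that(2)]] by simp
  have mult_nat: "real n * x \<in> G" if "x \<in> G" for x n
    by (induction n) (use zero add that in \<open>auto simp: algebra_simps\<close>)
  have mult: "of_int k * x \<in> G" if "x \<in> G" for x k
  proof (cases k)
    case (nonneg n)
    then show ?thesis using mult_nat[OF that, of n] by simp
  next
    case (neg n)
    then have "real_of_int k = - real (Suc n)" by simp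
    then have "of_int k * x = 0 - real (Suc n) * x" by (simp del: of_nat_Suc)
    then show ?thesis using sub[OF zero mult_nat[OF that, of "Suc n"]] by simp
  qed
  \<comment> \<open>\<open>m\<close> sorts the positive elements into cells of width
    \<open>e\<close>. Two elements in one cell differ by less than \<open>e\<close> and hence
    coincide, so an element in the lowest occupied cell is the least one.\<close>
  define m where "m x = nat \<lfloor>x / e\<rfloor>" for x
  obtain a where a: "a \<in> G" "a > 0" "\<And>y. y \<in> G \<Longrightarrow> y > 0 \<Longrightarrow> m a \<le> m y"
    using ex_has_least_nat[of "\<lambda>y. y \<in> G \<and> y > 0" x0 m] assms by blast
  have min: "a \<le> y" if y: "y \<in> G" "y > 0" for y
  proof (rule ccontr)
    assume "\<not> a \<le> y"
    moreover have "\<lfloor>a / e\<rfloor> \<le> \<lfloor>y / e\<rfloor>"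
    proof -
      have "\<lfloor>y / e\<rfloor> \<ge> 0" using y e by simp
      with a(3)[OF y] show ?thesis unfolding m_def by linarith
    qed
    moreover have "\<lfloor>y / e\<rfloor> \<le> \<lfloor>a / e\<rfloor>"
      using calculation(1) e(1) by (intro floor_mono divide_right_mono) auto
    ultimately have "\<lfloor>a / e\<rfloor> = \<lfloor>y / e\<rfloor>" by simp
    then have "\<bar>a / e - y / e\<bar> < 1" by linarith
    then have "\<bar>a - y\<bar> < e" using e(1) by (simp flip: diff_divide_distrib)
    then have "a - y = 0" using e(2) sub a(1) y(1) by blast
    with \<open>\<not> a \<le> y\<close> show False by simp
  qed
  have "x = of_int \<lfloor>x / a\<rfloor> * a" if x: "x \<in> G" for x
  proof -
    define y where "y = x - of_int \<lfloor>x / a\<rfloor> * a"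
    have "y \<in> G" unfolding y_def by (intro sub x mult a)
    have "of_int \<lfloor>x / a\<rfloor> * a \<le> x / a * a" "x / a * a < (of_int \<lfloor>x / a\<rfloor> + 1) * a"
      using a(2) by (intro mult_right_mono mult_strict_right_mono; linarith)+
    then have "0 \<le> y" "y < a"
      using a(2) by (auto simp: y_def distrib_right)
    with min[OF \<open>y \<in> G\<close>] have "y = 0" by force
    then show ?thesis by (simp add: y_def)
  qed
  with a(2) that show ?thesis by blast
qed

section \<open>What the lattice and the nonlattice property say about the steps\<close>

lemma not_lattice_ifs_imp:
  assumes "\<not> lattice_ifs N r" "\<eta> > 0"
  obtains u v where "u \<in> semigroup_hull ((\<lambda>j. - ln (r j)) ` {1..N})"
    "v \<in> semigroup_hull ((\<lambda>j. - ln (r j)) ` {1..N})" "0 < u - v" "u - v < \<eta>"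
proof -
  define S where "S = (\<lambda>j. - ln (r j)) ` {1..N}"
  define G where "G = {u - v |u v. u \<in> semigroup_hull S \<and> v \<in> semigroup_hull S}"
  note sg = semigroup_differences_subgroup[where S = S, folded G_def]
  have "continuous_on (words N) (geometric_potential r)"
  proof -
    have "continuous_on (words N) (\<lambda>\<omega>. \<omega> 0)"
      by (rule continuous_on_subset[OF continuous_on_product_coordinates]) simp
    then have "continuous_on (words N) ((\<lambda>i. - ln (r i)) \<circ> (\<lambda>\<omega>. \<omega> 0))"
      by (intro continuous_on_compose) (auto intro: continuous_on_discrete)
    then show ?thesis by (simp add: geometric_potential_def[abs_def] o_def)
  qed
  moreover have "geometric_potential r ` words N \<subseteq> G"
    using sg(3) by (auto simp: geometric_potential_def words_def S_def)
  \<comment> \<open>If \<open>G\<close> were discrete, \<open>\<zeta>\<close> equal to the potential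
    itself and \<open>\<psi> = 0\<close> would witness the lattice property. So \<open>G\<close>
    contains nonzero elements below any bound.\<close>
  moreover have "continuous_on (words N) (\<lambda>_. 0 :: real)" by simp
  ultimately have "\<not> discrete_subgroup G"
    using assms(1) unfolding lattice_ifs_def by fastforce
  then obtain x where x: "x \<in> G" "\<bar>x\<bar> < \<eta>" "x \<noteq> 0"
    using discrete_subgroupI[of G \<eta>] sg assms by metis
  then obtain u v where uv: "x = u - v" "u \<in> semigroup_hull S" "v \<in> semigroup_hull S"
    unfolding G_def by blast
  show ?thesis
    using that[of u v] that[of v u] uv x unfolding S_def by (cases "x > 0") auto
qed

text \<open>Constant words are fixed by the shift, so the coboundary
  \<open>\<psi> - \<psi> \<circ> shift\<close> vanishes there. Hence each \<open>- ln (r j)\<close>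
  is a value of \<open>\<zeta>\<close> and lies in one cyclic group.\<close>

lemma lattice_ifs_imp:
  assumes "lattice_ifs N r" "N \<ge> 1" "\<And>j. j \<in> {1..N} \<Longrightarrow> 0 < r j \<and> r j < 1"
  obtains a k where "a > 0" "\<And>j. j \<in> {1..N} \<Longrightarrow> k j \<ge> 1 \<and> - ln (r j) = real (k j) * a"
proof -
  obtain \<zeta> \<psi> :: "(nat \<Rightarrow> nat) \<Rightarrow> real" and G where
    eq: "\<And>\<omega>. \<omega> \<in> words N \<Longrightarrow> geometric_potential r \<omega> - \<zeta> \<omega> = \<psi> \<omega> - \<psi> (shift \<omega>)"
    and G: "discrete_subgroup G" "\<zeta> ` words N \<subseteq> G"
    using assms(1) unfolding lattice_ifs_def by blast
  have inG: "- ln (r j) \<in> G" if "j \<in> {1..N}" for j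
  proof -
    have w: "(\<lambda>_. j) \<in> words N" using that by (auto simp: words_def)
    have "shift (\<lambda>_. j) = (\<lambda>_. j)" by (simp add: shift_def)
    then have "- ln (r j) = \<zeta> (\<lambda>_. j)"
      using eq[OF w] by (simp add: geometric_potential_def)
    then show ?thesis using w G(2) by auto
  qed
  have pos: "- ln (r j) > 0" if "j \<in> {1..N}" for j
    using assms(3)[OF that] by simp
  obtain a where a: "a > 0" "\<And>x. x \<in> G \<Longrightarrow> \<exists>k::int. x = of_int k * a"
    using discrete_subgroup_cyclic[OF G(1) inG[of 1] pos[of 1]] assms(2) by auto
  have "\<exists>k::nat. k \<ge> 1 \<and> - ln (r j) = real k * a" if j: "j \<in> {1..N}" for j
  proof -
    obtain k :: int where k: "- ln (r j) = of_int k * a" using a(2)[OF inG[OF j]] by blast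
    then have "k > 0" using pos[OF j] a(1) by (simp add: zero_less_mult_iff)
    then show ?thesis using k by (intro exI[of _ "nat k"]) auto
  qed
  then obtain k :: "nat \<Rightarrow> nat" where "\<And>j. j \<in> {1..N} \<Longrightarrow> k j \<ge> 1 \<and> - ln (r j) = real (k j) * a"
    by metis
  with a(1) that show ?thesis by blast
qed

section \<open>The renewal theorem for finitely many steps\<close>

text \<open>A random step takes the value \<open>s j\<close> with probability \<open>p j\<close>;
  \<open>mean\<close> is its expectation.\<close>

locale renewal =
  fixes J :: "'a set" and p s :: "'a \<Rightarrow> real"
  assumes finite_J: "finite J"
    and p_pos: "j \<in> J \<Longrightarrow> 0 < p j"
    and p_sum: "(\<Sum>j\<in>J. p j) = 1"
    and s_pos: "j \<in> J \<Longrightarrow> 0 < s j"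
begin

definition mean :: real where
  "mean = (\<Sum>j\<in>J. p j * s j)"

lemma J_nonempty: "J \<noteq> {}"
  using p_sum by auto

lemma mean_pos: "mean > 0"
  unfolding mean_def using finite_J J_nonempty p_pos s_pos by (intro sum_pos) auto

lemma s_lower:
  obtains \<sigma> where "\<sigma> > 0" "\<And>j. j \<in> J \<Longrightarrow> \<sigma> \<le> s j"
  using that[of "Min (s ` J)"] finite_J J_nonempty s_pos by (auto simp: Min_gr_iff)

lemma s_upper:
  obtains S where "S > 0" "\<And>j. j \<in> J \<Longrightarrow> s j \<le> S"
proof -
  obtain j where j: "j \<in> J" using J_nonempty by blast
  have "s i \<le> Max (s ` J)" if "i \<in> J" for i
    using that finite_J by simp
  moreover from this[OF j] have "Max (s ` J) > 0" using s_pos[OF j] by linarith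
  ultimately show ?thesis using that by blast
qed

text \<open>An induction over the reals: the steps are at least some \<open>\<sigma> > 0\<close>, so
  each round extends the validity of \<open>P\<close> by \<open>\<sigma>\<close>, and finitely many
  rounds reach any \<open>t\<close>.\<close>

lemma renewal_induct:
  assumes base: "\<And>t. t \<le> T \<Longrightarrow> P t"
    and step: "\<And>t. T < t \<Longrightarrow> (\<And>j. j \<in> J \<Longrightarrow> P (t - s j)) \<Longrightarrow> P t"
  shows "P t"
proof -
  obtain \<sigma> where \<sigma>: "\<sigma> > 0" "\<And>j. j \<in> J \<Longrightarrow> \<sigma> \<le> s j" by (rule s_lower) blast
  have "\<forall>t \<le> T + real n * \<sigma>. P t" for n
  proof (induction n)
    case 0
    then show ?case using base by simp
  next
    case (Suc n)
    show ?case
    proof (intro allI impI)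
      fix t assume t: "t \<le> T + real (Suc n) * \<sigma>"
      have "P (t - s j)" if "j \<in> J" for j
        using \<sigma>(2)[OF that] t by (intro Suc.IH[rule_format]) (simp add: algebra_simps)
      then show "P t" using base step by (cases "t \<le> T") auto
    qed
  qed
  moreover obtain n where "(t - T) / \<sigma> \<le> real n" using real_arch_simple by blast
  then have "t \<le> T + real n * \<sigma>" using \<sigma>(1) by (simp add: field_simps)
  ultimately show ?thesis by blast
qed

lemma eventually_all_J:
  assumes "\<And>j. j \<in> J \<Longrightarrow> eventually (P j) F"
  shows "eventually (\<lambda>x. \<forall>j\<in>J. P j x) F"
  using assms finite_J by (simp add: eventually_ball_finite)

text \<open>If the defect of \<open>D\<close> is below \<open>\<eta>\<close> past \<open>T\<close>,
  a line of slope \<open>\<eta> / \<sigma>\<close> dominates \<open>\<bar>D\<bar>\<close>: going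
  back by a step lowers the line by at least \<open>\<eta>\<close>, which absorbs the
  defect.\<close>

lemma sublinear:
  assumes lim: "((\<lambda>t. D t - (\<Sum>j\<in>J. p j * D (t - s j))) \<longlongrightarrow> 0) at_top"
    and bdd: "\<And>a b. bounded (D ` {a..b})"
  shows "((\<lambda>t. D t / t) \<longlongrightarrow> 0) at_top"
proof -
  obtain \<sigma> where \<sigma>: "\<sigma> > 0" "\<And>j. j \<in> J \<Longrightarrow> \<sigma> \<le> s j" by (rule s_lower) blast
  obtain S where S: "S > 0" "\<And>j. j \<in> J \<Longrightarrow> s j \<le> S" by (rule s_upper) blast
  have small: "eventually (\<lambda>t. \<bar>D t / t\<bar> < \<epsilon>) at_top" if "\<epsilon> > 0" for \<epsilon>
  proof -
    \<comment> \<open>This choice makes the slope \<open>\<eta> / \<sigma>\<close> of the dominating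
      line equal to \<open>\<epsilon> / 2\<close>.\<close>
    define \<eta> where "\<eta> = \<epsilon> * \<sigma> / 2"
    have \<eta>: "\<eta> > 0" using that \<sigma> by (simp add: \<eta>_def)
    obtain T where T: "\<And>t. t \<ge> T \<Longrightarrow> \<bar>D t - (\<Sum>j\<in>J. p j * D (t - s j))\<bar> < \<eta>"
      using tendstoD[OF lim \<eta>] by (auto simp: eventually_at_top_linorder dist_real_def)
    \<comment> \<open>The starting window has length \<open>S\<close> because every
      \<open>t - s j\<close> with \<open>t > T\<close> stays above \<open>T - S\<close>.\<close>
    obtain K where K: "\<And>t. t \<in> {T - S..T} \<Longrightarrow> \<bar>D t\<bar> \<le> K"
      using bdd[of "T - S" T] unfolding bounded_iff by (metis imageI real_norm_def)
    have bound: "T - S \<le> t \<longrightarrow> \<bar>D t\<bar> \<le> K + \<eta> / \<sigma> * (t - (T - S))" for t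
    proof (induction t rule: renewal_induct[of T])
      case (1 t)
      show ?case
      proof
        assume t: "T - S \<le> t"
        then have "0 \<le> \<eta> / \<sigma> * (t - (T - S))" using \<eta> \<sigma> by simp
        then show "\<bar>D t\<bar> \<le> K + \<eta> / \<sigma> * (t - (T - S))" using K[of t] 1 t by simp
      qed
    next
      case (2 t)
      have "\<bar>\<Sum>j\<in>J. p j * D (t - s j)\<bar> \<le> (\<Sum>j\<in>J. p j * (K + \<eta> / \<sigma> * (t - (T - S)) - \<eta>))"
      proof (intro order_trans[OF sum_abs] sum_mono)
        fix j assume j: "j \<in> J"
        have "T - S \<le> t - s j" using S(2)[OF j] 2(1) by simp
        then have "\<bar>D (t - s j)\<bar> \<le> K + \<eta> / \<sigma> * (t - s j - (T - S))" using 2(2)[OF j] by blast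
        also have "\<dots> = K + \<eta> / \<sigma> * (t - (T - S)) - \<eta> / \<sigma> * s j" by (simp add: algebra_simps)
        also have "\<dots> \<le> K + \<eta> / \<sigma> * (t - (T - S)) - \<eta>"
          using \<sigma>(2)[OF j] \<sigma>(1) \<eta> by (simp add: field_simps)
        finally show "\<bar>p j * D (t - s j)\<bar> \<le> p j * (K + \<eta> / \<sigma> * (t - (T - S)) - \<eta>)"
          using p_pos[OF j] by (simp add: abs_mult)
      qed
      also have "\<dots> = K + \<eta> / \<sigma> * (t - (T - S)) - \<eta>"
        using p_sum by (simp flip: sum_distrib_right)
      finally have "\<bar>D t\<bar> \<le> K + \<eta> / \<sigma> * (t - (T - S))"
        using T[of t] 2(1) by linarith
      then show ?case by simp
    qed
    have "((\<lambda>t. (K + \<eta> / \<sigma> * (t - (T - S))) / t) \<longlongrightarrow> \<epsilon> / 2) at_top"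
    proof -
      have lim: "((\<lambda>t. (K - \<eta> / \<sigma> * (T - S)) / t + \<eta> / \<sigma>) \<longlongrightarrow> 0 + \<eta> / \<sigma>) at_top"
        by (intro tendsto_intros real_tendsto_divide_at_top[OF tendsto_const] filterlim_ident)
      have eq: "\<eta> / \<sigma> = \<epsilon> / 2" using \<sigma> by (simp add: \<eta>_def)
      have ev: "eventually (\<lambda>t. (K - \<eta> / \<sigma> * (T - S)) / t + \<eta> / \<sigma>
          = (K + \<eta> / \<sigma> * (t - (T - S))) / t) at_top"
        using eventually_gt_at_top[of 0]
        by eventually_elim (simp add: add_divide_distrib diff_divide_distrib algebra_simps)
      show ?thesis
        unfolding eq[symmetric] using Lim_transform_eventually[OF lim ev] by (simp only: add_0)
    qed
    then have "eventually (\<lambda>t. (K + \<eta> / \<sigma> * (t - (T - S))) / t < \<epsilon>) at_top"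
      by (rule order_tendstoD(2)) (use that in simp)
    then show ?thesis
      using eventually_gt_at_top[of 0] eventually_ge_at_top[of "T - S"]
    proof eventually_elim
      case (elim t)
      then have "\<bar>D t\<bar> / t \<le> (K + \<eta> / \<sigma> * (t - (T - S))) / t"
        using bound[of t] by (intro divide_right_mono) auto
      then show ?case using elim by simp
    qed
  qed
  show ?thesis
    by (rule tendstoI) (use small in \<open>simp add: dist_real_def\<close>)
qed

text \<open>Wherever the solution \<open>f\<close> is close to its limit superior \<open>M\<close>, the renewal equation
  forces it to be close to \<open>M\<close> at all earlier times that differ by an element of the
  semigroup generated by the steps. Since these times are eventually dense, \<open>f\<close> is close to
  \<open>M\<close> on long intervals, and the conserved quantity \<open>\<Sum> p\<^sub>j (B t - B (t - s\<^sub>j))\<close> bounds \<open>M\<close>.\<close>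

lemma renewal_limsup:
  assumes deriv: "\<And>t. (B has_real_derivative f t) (at t)"
    and uc: "uniformly_continuous_on UNIV f"
    and bdd: "\<And>t. \<bar>f t\<bar> \<le> C"
    and rec: "((\<lambda>t. f t - (\<Sum>j\<in>J. p j * f (t - s j))) \<longlongrightarrow> 0) at_top"
    and cons: "((\<lambda>t. \<Sum>j\<in>J. p j * (B t - B (t - s j))) \<longlongrightarrow> I) at_top"
    and nonlattice: "\<And>\<eta>. \<eta> > 0 \<Longrightarrow>
      \<exists>u\<in>semigroup_hull (s ` J). \<exists>v\<in>semigroup_hull (s ` J). 0 < u - v \<and> u - v < \<eta>"
    and "\<epsilon> > 0"
  shows "eventually (\<lambda>t. f t < I / mean + \<epsilon>) at_top"
proof -
  \<comment> \<open>\<open>M\<close>, the infimum of the eventual upper bounds of \<open>f\<close>,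
    is its limit superior.\<close>
  define U where "U = {c. eventually (\<lambda>t. f t \<le> c) at_top}"
  define M where "M = Inf U"
  have "C \<in> U" unfolding U_def using bdd by (auto intro!: always_eventually simp: abs_le_iff)
  moreover have U_lower: "- C \<le> c" if "c \<in> U" for c
  proof -
    from that obtain T where "f T \<le> c" by (auto simp: U_def eventually_at_top_linorder)
    then show ?thesis using bdd[of T] by linarith
  qed
  ultimately have U: "U \<noteq> {}" "bdd_below U" by (auto intro: bdd_belowI[of U "- C"])
  have upper: "eventually (\<lambda>t. f t < M + e) at_top" if e: "e > 0" for e
  proof -
    obtain c where c: "c \<in> U" "c < M + e"
      using e U unfolding M_def by (metis cInf_lessD less_add_same_cancel1)
    then show ?thesis by (auto simp: U_def elim: eventually_mono)
  qed
  have freq: "\<exists>t\<ge>T. f t > M - e" if "e > 0" for e T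
  proof (rule ccontr)
    assume "\<not> (\<exists>t\<ge>T. f t > M - e)"
    then have "M - e \<in> U" by (auto simp: U_def eventually_at_top_linorder not_less)
    then have "M \<le> M - e" unfolding M_def using U by (intro cInf_lower)
    with that show False by simp
  qed
  \<comment> \<open>A sequence of times tending to infinity along which \<open>f\<close> approaches
    \<open>M\<close>.\<close>
  have "\<forall>n. \<exists>t. t \<ge> real n \<and> f t > M - inverse (real (Suc n))"
    using freq by simp
  then obtain \<tau> where \<tau>: "\<And>n. \<tau> n \<ge> real n" "\<And>n. f (\<tau> n) > M - inverse (real (Suc n))"
    by metis
  have \<tau>_top: "filterlim (\<lambda>n. \<tau> n - x) at_top sequentially" for x
  proof -
    have "filterlim \<tau> at_top sequentially"
      using \<tau>(1) by (intro filterlim_at_top_mono[OF filterlim_real_sequentially] always_eventually) auto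
    then show ?thesis
      using filterlim_tendsto_add_at_top[OF tendsto_const[of "- x"], of \<tau>] by simp
  qed
  have near: "\<forall>e>0. eventually (\<lambda>n. f (\<tau> n - x) > M - e) sequentially"
    if "x \<in> semigroup_hull (s ` J)" for x
    using that
  proof induction
    case zero
    show ?case
    proof (intro allI impI)
      fix e :: real assume "e > 0"
      then have "eventually (\<lambda>n. inverse (real (Suc n)) < e) sequentially"
        using order_tendstoD(2)[OF LIMSEQ_inverse_real_of_nat] by blast
      then show "eventually (\<lambda>n. f (\<tau> n - 0) > M - e) sequentially"
        by eventually_elim (use \<tau>(2) in \<open>force intro: less_trans[rotated]\<close>)
    qed
  next
    case (step x y)
    then obtain j where j: "j \<in> J" "y = s j" by auto
    show ?case
    proof (intro allI impI)
      fix e :: real assume e: "e > 0"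
      \<comment> \<open>Three errors of size \<open>d\<close> occur: in
        \<open>f (\<tau> n - x)\<close>, in the renewal equation, and in the bound
        \<open>M + d\<close> for the other summands. Together they cost
        \<open>3 * d = e * p j\<close>, that is \<open>e\<close> after division by
        \<open>p j\<close>.\<close>
      define d where "d = e * p j / 3"
      have d: "d > 0" using e p_pos[OF j(1)] by (simp add: d_def)
      have "eventually (\<lambda>n. f (\<tau> n - x) > M - d) sequentially"
        using step.IH d by blast
      moreover have "eventually (\<lambda>n. \<bar>f (\<tau> n - x) - (\<Sum>i\<in>J. p i * f (\<tau> n - x - s i))\<bar> < d) sequentially"
        using tendstoD[OF filterlim_compose[OF rec \<tau>_top[of x]] d] by (simp add: dist_real_def)
      moreover have "eventually (\<lambda>n. \<forall>i\<in>J. f (\<tau> n - x - s i) < M + d) sequentially"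
      proof (rule eventually_all_J)
        fix i
        show "eventually (\<lambda>n. f (\<tau> n - x - s i) < M + d) sequentially"
          using eventually_compose_filterlim[OF upper[OF d] \<tau>_top[of "x + s i"]]
          by (simp add: diff_diff_eq)
      qed
      ultimately show "eventually (\<lambda>n. f (\<tau> n - (x + y)) > M - e) sequentially"
      proof eventually_elim
        case (elim n)
        have "(\<Sum>i\<in>J - {j}. p i * f (\<tau> n - x - s i)) \<le> (\<Sum>i\<in>J - {j}. p i * (M + d))"
          using elim(3) p_pos by (intro sum_mono mult_left_mono) (auto intro: less_imp_le)
        also have "\<dots> = (1 - p j) * (M + d)"
          using j finite_J p_sum by (simp flip: sum_distrib_right add: sum_diff1)
        finally have "p j * f (\<tau> n - x - s j) \<ge> f (\<tau> n - x) - d - (1 - p j) * (M + d)"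
          using elim(2) j finite_J by (simp add: sum.remove[of J j])
        moreover have "f (\<tau> n - x) - d - (1 - p j) * (M + d) > p j * M - 3 * d + p j * d"
          using elim(1) by (simp add: algebra_simps)
        ultimately have "p j * f (\<tau> n - x - s j) > p j * M - 3 * d + p j * d" by linarith
        then have "p j * f (\<tau> n - x - s j) > p j * (M - e)"
          using p_pos[OF j(1)] d mult_pos_pos[OF p_pos[OF j(1)] d] by (simp add: d_def algebra_simps)
        then show ?case using p_pos[OF j(1)] j(2) by (simp add: diff_diff_eq)
      qed
    qed
  qed
  have "mean * (M - e) \<le> I" if e: "e > 0" for e
  proof -
    obtain S where S: "S > 0" "\<And>j. j \<in> J \<Longrightarrow> s j \<le> S" by (rule s_upper) blast
    obtain \<eta> where \<eta>: "\<eta> > 0" "\<And>x y. \<bar>x - y\<bar> < \<eta> \<Longrightarrow> \<bar>f x - f y\<bar> < e / 2"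
      using uc e unfolding uniformly_continuous_on_def dist_real_def
      by (metis UNIV_I half_gt_zero)
    obtain u v where uv: "u \<in> semigroup_hull (s ` J)" "v \<in> semigroup_hull (s ` J)"
      "0 < u - v" "u - v < \<eta>"
      using nonlattice[OF \<eta>(1)] by blast
    define x where "x = u - v"
    obtain m where m: "S / x \<le> real m" using real_arch_simple by blast
    have x: "0 < x" "x < \<eta>" using uv by (auto simp: x_def)
    \<comment> \<open>With this offset, \<open>T + k * x = k * u + (m - k) * v\<close> is a lag in
      the semigroup for every \<open>k \<le> m\<close>. These lags form a grid of mesh
      \<open>x < \<eta>\<close> that covers a length of at least \<open>S\<close>.\<close>
    define T where "T = real m * v"
    have mem: "T + real k * x \<in> semigroup_hull (s ` J)" if "k \<le> m" for k
    proof -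
      have "T + real k * x = real k * u + real (m - k) * v"
        using that by (simp add: T_def x_def of_nat_diff algebra_simps)
      then show ?thesis using uv semigroup_mult semigroup_add by metis
    qed
    have "eventually (\<lambda>n. \<forall>k\<in>{..m}. f (\<tau> n - (T + real k * x)) > M - e / 2) sequentially"
      using near[OF mem] e by (intro eventually_ball_finite) auto
    then have "eventually (\<lambda>n. (\<Sum>j\<in>J. p j * (B (\<tau> n - T) - B (\<tau> n - T - s j))) \<ge> mean * (M - e)) sequentially"
    proof eventually_elim
      case (elim n)
      have low: "f (\<tau> n - T - y) > M - e" if y: "0 \<le> y" "y \<le> S" for y
      proof -
        \<comment> \<open>Rounding \<open>y\<close> down to the grid moves the argument by less than
          \<open>\<eta>\<close>, so uniform continuity costs only \<open>e / 2\<close>.\<close>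
        define k where "k = nat \<lfloor>y / x\<rfloor>"
        have k: "real k = of_int \<lfloor>y / x\<rfloor>" using y x by (simp add: k_def)
        have "real k \<le> y / x" "y / x < real k + 1" unfolding k by linarith+
        then have kx: "real k * x \<le> y" "y < real k * x + x" using x by (auto simp: field_simps)
        have "y / x \<le> S / x" using y x by (intro divide_right_mono) auto
        with \<open>real k \<le> y / x\<close> m have "real k \<le> real m" by linarith
        then have "f (\<tau> n - (T + real k * x)) > M - e / 2" using elim by simp
        moreover have "\<bar>(\<tau> n - (T + real k * x)) - (\<tau> n - T - y)\<bar> < \<eta>" using kx x by simp
        then have "\<bar>f (\<tau> n - (T + real k * x)) - f (\<tau> n - T - y)\<bar> < e / 2" by (rule \<eta>(2))
        ultimately show ?thesis by linarith
      qed
      have "mean * (M - e) = (\<Sum>j\<in>J. p j * (s j * (M - e)))"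
        by (simp add: mean_def sum_distrib_right mult.assoc)
      also have "\<dots> \<le> (\<Sum>j\<in>J. p j * (B (\<tau> n - T) - B (\<tau> n - T - s j)))"
      proof (intro sum_mono mult_left_mono)
        fix j assume j: "j \<in> J"
        show "0 \<le> p j" using p_pos[OF j] by simp
        \<comment> \<open>By the mean value theorem the increment of \<open>B\<close> is
          \<open>s j\<close> times a value of \<open>f\<close> at a point of the window, where
          \<open>f\<close> exceeds \<open>M - e\<close>.\<close>
        obtain z where z: "\<tau> n - T - s j < z" "z < \<tau> n - T"
          "B (\<tau> n - T) - B (\<tau> n - T - s j) = s j * f z"
          using MVT2[of "\<tau> n - T - s j" "\<tau> n - T" B f] deriv s_pos[OF j] by auto
        have "f z > M - e"
          using low[of "\<tau> n - T - z"] z S(2)[OF j] by simp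
        then show "s j * (M - e) \<le> B (\<tau> n - T) - B (\<tau> n - T - s j)"
          using z(3) s_pos[OF j] by simp
      qed
      finally show ?case .
    qed
    then show ?thesis
      using tendsto_lowerbound[OF filterlim_compose[OF cons \<tau>_top[of T]]] by simp
  qed
  then have "M - e \<le> I / mean" if "e > 0" for e
    using that mean_pos by (simp add: field_simps)
  then have "M \<le> I / mean"
    by (meson field_le_epsilon diff_le_eq)
  then show ?thesis
    using upper[OF \<open>\<epsilon> > 0\<close>] by (auto elim: eventually_mono)
qed

text \<open>All hypotheses are stable under changing the signs of \<open>f\<close>, \<open>B\<close>
  and \<open>I\<close>, so the bound on the limit superior of \<open>- f\<close> bounds the limit
  inferior of \<open>f\<close>.\<close>

theorem renewal_limit:
  assumes deriv: "\<And>t. (B has_real_derivative f t) (at t)"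
    and uc: "uniformly_continuous_on UNIV f"
    and bdd: "\<And>t. \<bar>f t\<bar> \<le> C"
    and rec: "((\<lambda>t. f t - (\<Sum>j\<in>J. p j * f (t - s j))) \<longlongrightarrow> 0) at_top"
    and cons: "((\<lambda>t. \<Sum>j\<in>J. p j * (B t - B (t - s j))) \<longlongrightarrow> I) at_top"
    and nonlattice: "\<And>\<eta>. \<eta> > 0 \<Longrightarrow>
      \<exists>u\<in>semigroup_hull (s ` J). \<exists>v\<in>semigroup_hull (s ` J). 0 < u - v \<and> u - v < \<eta>"
  shows "(f \<longlongrightarrow> I / mean) at_top"
proof (rule tendstoI)
  fix \<epsilon> :: real assume \<epsilon>: "\<epsilon> > 0"
  have "eventually (\<lambda>t. - f t < (- I) / mean + \<epsilon>) at_top"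
  proof (rule renewal_limsup[where B = "\<lambda>t. - B t" and C = C])
    show "((\<lambda>t. - B t) has_real_derivative - f t) (at t)" for t
      by (intro derivative_intros deriv)
    show "((\<lambda>t. - f t - (\<Sum>j\<in>J. p j * - f (t - s j))) \<longlongrightarrow> 0) at_top"
      using tendsto_minus[OF rec] by (simp add: sum_negf)
    show "((\<lambda>t. \<Sum>j\<in>J. p j * (- B t - - B (t - s j))) \<longlongrightarrow> - I) at_top"
      using tendsto_minus[OF cons] by (simp flip: sum_negf add: algebra_simps)
  qed (use uc bdd nonlattice \<epsilon> in \<open>auto intro: uniformly_continuous_on_minus\<close>)
  moreover have "eventually (\<lambda>t. f t < I / mean + \<epsilon>) at_top"
    using renewal_limsup[OF assms \<epsilon>] .
  ultimately show "eventually (\<lambda>t. dist (f t) (I / mean) < \<epsilon>) at_top"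
    by eventually_elim (simp add: dist_real_def abs_less_iff)
qed

end

section \<open>The renewal equation of a gap recursion\<close>

text \<open>The variable is \<open>t = - ln \<epsilon>\<close>, and \<open>v t\<close> plays the
  role of \<open>V \<epsilon>\<close>. Replacing \<epsilon> by \<open>\<epsilon> / r j\<close>
  becomes the translation \<open>t + ln (r j)\<close>; for \<open>t \<le> t\<^sub>0\<close> the
  parallel set covers the whole hull, whose length is \<open>w\<close>.\<close>

locale gap_recursion =
  fixes J :: "'a set" and r :: "'a \<Rightarrow> real" and G :: "'b set" and len :: "'b \<Rightarrow> real"
    and v :: "real \<Rightarrow> real" and w t\<^sub>0 \<delta> :: real
  assumes finite_J: "finite J" and card_J: "2 \<le> card J"
    and r_pos: "j \<in> J \<Longrightarrow> 0 < r j" and r_less_1: "j \<in> J \<Longrightarrow> r j < 1"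
    and moran: "(\<Sum>j\<in>J. r j powr \<delta>) = 1"
    and \<delta>_pos: "0 < \<delta>" and \<delta>_less_1: "\<delta> < 1"
    and finite_G: "finite G" and len_pos: "L \<in> G \<Longrightarrow> 0 < len L"
    and w_pos: "0 < w" and v_const: "t \<le> t\<^sub>0 \<Longrightarrow> v t = w"
    and v_rec_ln: "v t = (\<Sum>j\<in>J. r j * v (t + ln (r j))) + (\<Sum>L\<in>G. min (len L) (2 * exp (- t)))"
begin

definition s :: "'a \<Rightarrow> real" where "s j = - ln (r j)"
definition p :: "'a \<Rightarrow> real" where "p j = r j powr \<delta>"
definition g :: "real \<Rightarrow> real" where "g t = (\<Sum>L\<in>G. min (len L) (2 * exp (- t)))"
definition f :: "real \<Rightarrow> real" where "f t = exp ((1 - \<delta>) * t) * v t"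
definition z :: "real \<Rightarrow> real" where "z t = exp ((1 - \<delta>) * t) * g t"

sublocale renewal J p s
proof
  show "0 < p j" if "j \<in> J" for j using r_pos[OF that] by (simp add: p_def)
  show "0 < s j" if "j \<in> J" for j using r_pos[OF that] r_less_1[OF that] by (simp add: s_def)
qed (use finite_J moran in \<open>auto simp: p_def\<close>)

lemma v_rec: "v t = (\<Sum>j\<in>J. r j * v (t - s j)) + g t"
  using v_rec_ln[of t] by (simp add: s_def g_def)

lemma f_rec: "f t = (\<Sum>j\<in>J. p j * f (t - s j)) + z t"
proof -
  have "exp ((1 - \<delta>) * t) * (r j * v (t - s j)) = p j * f (t - s j)" if "j \<in> J" for j
  proof -
    have "exp ((1 - \<delta>) * (t - s j)) = exp ((1 - \<delta>) * t) * r j powr (1 - \<delta>)"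
      using r_pos[OF that] by (simp add: s_def powr_def algebra_simps flip: exp_add)
    moreover have "r j powr \<delta> * r j powr (1 - \<delta>) = r j"
      using r_pos[OF that] by (simp flip: powr_add)
    ultimately show ?thesis by (simp add: f_def p_def)
  qed
  then show ?thesis
    unfolding f_def[of t] v_rec[of t] z_def by (simp add: distrib_left sum_distrib_left)
qed

section \<open>Bounds and uniform continuity of the rescaled solution\<close>

lemma g_nonneg: "0 \<le> g t"
  unfolding g_def using len_pos by (intro sum_nonneg) (auto intro: less_imp_le)

lemma g_le: "g t \<le> 2 * card G * exp (- t)"
  unfolding g_def using sum_bounded_above[of G "\<lambda>L. min (len L) (2 * exp (- t))" "2 * exp (- t)"]
  by simp

lemma z_nonneg: "0 \<le> z t"
  unfolding z_def using g_nonneg by simp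

lemma z_le: "z t \<le> 2 * card G * exp (- \<delta> * t)"
proof -
  have "z t \<le> exp ((1 - \<delta>) * t) * (2 * card G * exp (- t))"
    unfolding z_def by (intro mult_left_mono g_le) auto
  also have "\<dots> = 2 * card G * exp ((1 - \<delta>) * t - t)"
    by (simp add: exp_diff exp_minus field_simps)
  finally show ?thesis by (simp add: algebra_simps)
qed

lemma v_pos: "0 < v t"
proof (induction t rule: renewal_induct[of "t\<^sub>0"])
  case (1 t)
  then show ?case using v_const w_pos by simp
next
  case (2 t)
  have "0 < (\<Sum>j\<in>J. r j * v (t - s j))"
    using 2(2) r_pos finite_J J_nonempty by (intro sum_pos) auto
  then show ?case unfolding v_rec[of t] using g_nonneg[of t] by simp
qed

lemma v_antimono:
  assumes "h \<ge> 0"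
  shows "v t \<le> v (t - h)"
proof (induction t rule: renewal_induct[of "t\<^sub>0"])
  case (1 t)
  then show ?case using v_const assms by simp
next
  case (2 t)
  have "(\<Sum>j\<in>J. r j * v (t - s j)) \<le> (\<Sum>j\<in>J. r j * v (t - h - s j))"
    using 2(2) r_pos by (intro sum_mono mult_left_mono) (auto simp: algebra_simps less_imp_le)
  moreover have "g t \<le> g (t - h)"
    unfolding g_def using assms by (intro sum_mono min.mono) auto
  ultimately show ?case unfolding v_rec[of t] v_rec[of "t - h"] by simp
qed

text \<open>In terms of \<epsilon>, enlarging the radius by the factor \<open>exp h\<close> enlarges
  each \<open>min (len L) (2 * \<epsilon>)\<close> at most by this factor, and the recursion with
  its positive coefficients inherits the bound.\<close>

lemma v_growth:
  assumes "h \<ge> 0"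
  shows "v (t - h) \<le> exp h * v t"
proof (induction t rule: renewal_induct[of "t\<^sub>0"])
  case (1 t)
  then show ?case using v_const assms w_pos by simp
next
  case (2 t)
  have "(\<Sum>j\<in>J. r j * v (t - h - s j)) \<le> (\<Sum>j\<in>J. r j * (exp h * v (t - s j)))"
    using 2(2) r_pos by (intro sum_mono mult_left_mono) (auto simp: algebra_simps less_imp_le)
  also have "\<dots> = exp h * (\<Sum>j\<in>J. r j * v (t - s j))"
    by (simp add: sum_distrib_left mult.left_commute)
  finally have "(\<Sum>j\<in>J. r j * v (t - h - s j)) \<le> exp h * (\<Sum>j\<in>J. r j * v (t - s j))" .
  moreover have "g (t - h) \<le> exp h * g t"
    unfolding g_def sum_distrib_left
  proof (rule sum_mono)
    fix L assume "L \<in> G"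
    then have "len L \<le> exp h * len L" using len_pos assms by simp
    moreover have "exp (- (t - h)) = exp h * exp (- t)" by (simp flip: exp_add)
    ultimately show "min (len L) (2 * exp (- (t - h))) \<le> exp h * min (len L) (2 * exp (- t))"
      by (simp add: min_mult_distrib_left min.coboundedI1)
  qed
  ultimately show ?case unfolding v_rec[of t] v_rec[of "t - h"] by (simp add: distrib_left)
qed

lemma f_pos: "0 < f t"
  unfolding f_def using v_pos by simp

text \<open>Averaging preserves a lower bound and \<open>z\<close> is nonnegative, so a bound on a
  window of length \<open>S\<close> propagates. The constant \<open>c\<close> is the value of
  \<open>f\<close> at the left end of this window, where \<open>f\<close> is still an increasing
  exponential.\<close>

lemma f_lower:
  obtains c where "c > 0" "\<And>t. t \<ge> t\<^sub>0 \<Longrightarrow> c \<le> f t"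
proof -
  obtain S where S: "S > 0" "\<And>j. j \<in> J \<Longrightarrow> s j \<le> S" by (rule s_upper) blast
  define c where "c = w * exp ((1 - \<delta>) * (t\<^sub>0 - S))"
  have "t\<^sub>0 - S \<le> t \<longrightarrow> c \<le> f t" for t
  proof (induction t rule: renewal_induct[of "t\<^sub>0"])
    case (1 t)
    then show ?case
      using v_const w_pos \<delta>_less_1 by (auto simp: c_def f_def mult.commute)
  next
    case (2 t)
    have "c = (\<Sum>j\<in>J. p j * c)" using p_sum by (simp flip: sum_distrib_right)
    also have "\<dots> \<le> (\<Sum>j\<in>J. p j * f (t - s j))"
    proof (intro sum_mono mult_left_mono)
      fix j assume j: "j \<in> J"
      show "0 \<le> p j" using p_pos[OF j] by simp
      show "c \<le> f (t - s j)" using 2 S(2)[OF j] j by simp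
    qed
    finally show ?case unfolding f_rec[of t] using z_nonneg[of t] by simp
  qed
  moreover have "c > 0" using w_pos by (simp add: c_def)
  ultimately show ?thesis using that[of c] S by simp
qed

text \<open>The correction \<open>D exp (- \<delta> t)\<close> turns the constant \<open>C\<close> into a supersolution: applying the
  averaging operator multiplies it by \<open>card J \<ge> 2\<close>, which absorbs the inhomogeneity \<open>z\<close>.\<close>

lemma f_upper:
  obtains C where "\<And>t. f t \<le> C"
proof -
  obtain S where S: "S > 0" "\<And>j. j \<in> J \<Longrightarrow> s j \<le> S" by (rule s_upper) blast
  define D where "D = 2 * real (card G)"
  define C where "C = w * exp ((1 - \<delta>) * t\<^sub>0) + D * exp (- \<delta> * (t\<^sub>0 - S))"
  have D: "D \<ge> 0" by (simp add: D_def)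
  have base: "f t \<le> w * exp ((1 - \<delta>) * t\<^sub>0)" if "t \<le> t\<^sub>0" for t
    using that v_const w_pos \<delta>_less_1 by (simp add: f_def mult.commute)
  have bound: "t\<^sub>0 - S \<le> t \<longrightarrow> f t \<le> C - D * exp (- \<delta> * t)" for t
  proof (induction t rule: renewal_induct[of "t\<^sub>0"])
    case (1 t)
    show ?case
    proof
      assume "t\<^sub>0 - S \<le> t"
      then have "exp (- \<delta> * t) \<le> exp (- \<delta> * (t\<^sub>0 - S))" using \<delta>_pos by simp
      then have "D * exp (- \<delta> * t) \<le> D * exp (- \<delta> * (t\<^sub>0 - S))" using D by (intro mult_left_mono)
      then show "f t \<le> C - D * exp (- \<delta> * t)" using base[OF 1] by (simp add: C_def)
    qed
  next
    case (2 t)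
    have "(\<Sum>j\<in>J. p j * f (t - s j)) \<le> (\<Sum>j\<in>J. p j * C - D * exp (- \<delta> * t))"
    proof (rule sum_mono)
      fix j assume j: "j \<in> J"
      have "f (t - s j) \<le> C - D * exp (- \<delta> * (t - s j))" using 2 S(2)[OF j] j by simp
      then have "p j * f (t - s j) \<le> p j * (C - D * exp (- \<delta> * (t - s j)))"
        using p_pos[OF j] by simp
      moreover have "p j * exp (- \<delta> * (t - s j)) = exp (- \<delta> * t)"
        using r_pos[OF j] by (simp add: p_def s_def powr_def algebra_simps flip: exp_add)
      ultimately show "p j * f (t - s j) \<le> p j * C - D * exp (- \<delta> * t)"
        by (simp add: right_diff_distrib mult.left_commute)
    qed
    also have "\<dots> = C - real (card J) * (D * exp (- \<delta> * t))"
      using p_sum by (simp add: sum_subtractf flip: sum_distrib_right)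
    also have "\<dots> \<le> C - 2 * (D * exp (- \<delta> * t))"
      using card_J D by (intro diff_left_mono mult_right_mono) auto
    finally show ?case
      unfolding f_rec[of t] using z_le[of t] by (simp add: D_def)
  qed
  have "f t \<le> C" for t
  proof (cases "t \<le> t\<^sub>0")
    case True
    then show ?thesis using base[of t] D by (simp add: C_def add_increasing2)
  next
    case False
    then have "f t \<le> C - D * exp (- \<delta> * t)" using bound[of t] S by simp
    moreover have "0 \<le> D * exp (- \<delta> * t)" using D by simp
    ultimately show ?thesis by linarith
  qed
  with that show ?thesis by blast
qed

text \<open>The monotonicity and the growth bound for \<open>v\<close> make \<open>f t\<close> and
  \<open>f (t - h)\<close> agree up to a factor \<open>exp h\<close> in both directions. As
  \<open>f \<le> C\<close>, this gives the modulus \<open>C * (exp h - 1)\<close>, which does not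
  depend on \<open>t\<close>.\<close>

lemma f_uniformly_continuous: "uniformly_continuous_on UNIV f"
proof -
  obtain C where C: "\<And>t. f t \<le> C" by (rule f_upper) blast
  have step: "\<bar>f t - f (t - h)\<bar> \<le> C * (exp h - 1)" if h: "h \<ge> 0" for t h
  proof -
    have e1: "exp ((1 - \<delta>) * t) = exp ((1 - \<delta>) * h) * exp ((1 - \<delta>) * (t - h))"
      by (simp add: algebra_simps flip: exp_add)
    have "f t \<le> exp ((1 - \<delta>) * h) * f (t - h)"
      unfolding f_def e1 using v_antimono[OF h, of t] by simp
    also have "\<dots> \<le> exp h * f (t - h)"
      using \<delta>_pos h f_pos[of "t - h"] by (intro mult_right_mono) (auto simp: algebra_simps)
    finally have "f t \<le> exp h * f (t - h)" .
    moreover have "f (t - h) \<le> exp h * f t"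
    proof -
      have "v (t - h) \<le> exp h * v t" by (rule v_growth[OF h])
      moreover have "exp ((1 - \<delta>) * (t - h)) \<le> exp ((1 - \<delta>) * t)" using \<delta>_less_1 h by simp
      ultimately show ?thesis
        unfolding f_def using v_pos[of "t - h"] mult_mono[of "exp ((1 - \<delta>) * (t - h))" "exp ((1 - \<delta>) * t)" "v (t - h)" "exp h * v t"]
        by (simp add: mult.left_commute)
    qed
    ultimately have "f t - f (t - h) \<le> (exp h - 1) * f (t - h)" "f (t - h) - f t \<le> (exp h - 1) * f t"
      by (simp_all add: algebra_simps)
    moreover have "(exp h - 1) * f x \<le> (exp h - 1) * C" for x
      using h C by (intro mult_left_mono) auto
    ultimately show ?thesis by (smt (verit) mult.commute)
  qed
  show ?thesis
    unfolding uniformly_continuous_on_def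
  proof (intro allI impI)
    fix e :: real assume e: "e > 0"
    have "((\<lambda>h. C * (exp h - 1)) \<longlongrightarrow> C * (exp 0 - 1)) (at 0)"
      by (intro tendsto_intros)
    then have "eventually (\<lambda>h. dist (C * (exp h - 1)) 0 < e) (at 0)"
      using tendstoD e by fastforce
    then obtain d where d: "d > 0" "\<And>h. h \<noteq> 0 \<Longrightarrow> \<bar>h\<bar> < d \<Longrightarrow> C * (exp h - 1) < e"
      unfolding eventually_at by (auto simp: dist_real_def abs_less_iff)
    have "\<bar>f x - f y\<bar> < e" if "\<bar>x - y\<bar> < d" for x y
    proof (cases "x = y")
      case False
      have "\<bar>f x - f y\<bar> \<le> C * (exp \<bar>x - y\<bar> - 1)"
        using step[of "x - y" x] step[of "y - x" y] by (cases "x \<ge> y") (auto simp: abs_minus_commute)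
      then show ?thesis using d(2)[of "\<bar>x - y\<bar>"] False that by simp
    qed (use e in simp)
    then show "\<exists>d>0. \<forall>x\<in>UNIV. \<forall>x'\<in>UNIV. dist x' x < d \<longrightarrow> dist (f x') (f x) < e"
      using d(1) by (auto simp: dist_real_def)
  qed
qed

lemma f_antiderivative:
  obtains B where "\<And>t. (B has_real_derivative f t) (at t)"
proof -
  have "isCont f x" for x
    using uniformly_continuous_imp_continuous[OF f_uniformly_continuous]
    by (simp add: continuous_on_eq_continuous_at)
  then show ?thesis
    using einterval_antiderivative[of "-\<infinity>" \<infinity> f] that
    by (auto simp: has_real_derivative_iff_has_vector_derivative)
qed

section \<open>Limits at infinity, the contribution of a single gap and the conserved
  quantity\<close>

lemma exp_tendsto_0: "((\<lambda>t. exp (- \<delta> * t)) \<longlongrightarrow> 0) at_top"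
proof -
  have "filterlim (\<lambda>t. \<delta> * t) at_top at_top"
    using \<delta>_pos by (intro filterlim_tendsto_pos_mult_at_top[OF tendsto_const] filterlim_ident)
  then show ?thesis
    using filterlim_compose[OF exp_at_bot filterlim_compose[OF filterlim_uminus_at_bot_at_top]]
    by force
qed

lemma z_tendsto: "(z \<longlongrightarrow> 0) at_top"
proof (rule tendsto_sandwich[of "\<lambda>_. 0" z at_top "\<lambda>t. 2 * card G * exp (- \<delta> * t)"])
  show "((\<lambda>t. 2 * card G * exp (- \<delta> * t)) \<longlongrightarrow> 0) at_top"
    by (intro tendsto_mult_right_zero exp_tendsto_0)
qed (use z_nonneg z_le in auto)

lemma rec_tendsto: "((\<lambda>t. f t - (\<Sum>j\<in>J. p j * f (t - s j))) \<longlongrightarrow> 0) at_top"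
proof -
  have "f t - (\<Sum>j\<in>J. p j * f (t - s j)) = z t" for t
    using f_rec[of t] by simp
  then show ?thesis using z_tendsto by simp
qed

definition gap_mass :: "real \<Rightarrow> real" where
  "gap_mass l = 2 powr (1 - \<delta>) * l powr \<delta> / (\<delta> * (1 - \<delta>))"

text \<open>The primitive of \<open>exp ((1 - \<delta>) * t) * min l (2 * exp (- t))\<close> that
  vanishes at minus infinity. The minimum changes branch at the kink \<open>- ln (l / 2)\<close>;
  continuity there forces the constant \<open>gap_mass l\<close>, which is therefore the integral
  over the whole line.\<close>

definition gap_primitive :: "real \<Rightarrow> real \<Rightarrow> real" where
  "gap_primitive l t = (if t \<le> - ln (l / 2) then l * exp ((1 - \<delta>) * t) / (1 - \<delta>)
     else gap_mass l - 2 * exp (- \<delta> * t) / \<delta>)"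

lemma exp_le_iff_kink:
  fixes l t :: real
  assumes "0 < l"
  shows "t \<le> - ln (l / 2) \<longleftrightarrow> l \<le> 2 * exp (- t)"
proof -
  have "t \<le> - ln (l / 2) \<longleftrightarrow> ln (l / 2) \<le> - t" by linarith
  also have "\<dots> \<longleftrightarrow> l / 2 \<le> exp (- t)" using assms exp_le_cancel_iff[of "ln (l / 2)" "- t"] by simp
  finally show ?thesis by (simp add: mult.commute)
qed

lemma gap_primitive_kink:
  assumes l: "0 < l"
  shows "l * exp ((1 - \<delta>) * (- ln (l / 2))) / (1 - \<delta>) = gap_mass l - 2 * exp (- \<delta> * (- ln (l / 2))) / \<delta>"
proof -
  have e1: "exp ((1 - \<delta>) * (- ln (l / 2))) = (l / 2) powr (\<delta> - 1)"
    using l by (simp add: powr_def algebra_simps)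
  have e2: "exp (- \<delta> * (- ln (l / 2))) = (l / 2) powr \<delta>"
    using l by (simp add: powr_def)
  have "(l / 2) powr \<delta> = l powr \<delta> / 2 powr \<delta>"
    using l by (simp add: powr_divide)
  then have e3: "2 * (l / 2) powr \<delta> = 2 powr (1 - \<delta>) * l powr \<delta>"
    by (simp add: powr_diff)
  have e4: "l * (l / 2) powr (\<delta> - 1) = 2 * (l / 2) powr \<delta>"
    using l by (simp add: powr_diff)
  show ?thesis
    unfolding e1 e2 e3 e4 gap_mass_def using \<delta>_pos \<delta>_less_1 by (simp add: field_simps)
qed

lemma continuous_gap_primitive:
  assumes l: "0 < l"
  shows "continuous_on UNIV (gap_primitive l)"
proof -
  have "continuous_on ({..- ln (l / 2)} \<union> {- ln (l / 2)..})
      (\<lambda>t. if t \<le> - ln (l / 2) then l * exp ((1 - \<delta>) * t) / (1 - \<delta>)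
         else gap_mass l - 2 * exp (- \<delta> * t) / \<delta>)"
    using \<delta>_pos \<delta>_less_1 gap_primitive_kink[OF l]
    by (intro continuous_on_cases continuous_intros) (auto dest: antisym)
  moreover have "{..- ln (l / 2)} \<union> {- ln (l / 2)..} = UNIV" by auto
  ultimately show ?thesis unfolding gap_primitive_def[abs_def] by simp
qed

lemma has_derivative_gap_primitive:
  assumes l: "0 < l" and t: "t \<noteq> - ln (l / 2)"
  shows "(gap_primitive l has_real_derivative exp ((1 - \<delta>) * t) * min l (2 * exp (- t))) (at t)"
proof (cases "t < - ln (l / 2)")
  case True
  have "((\<lambda>t. l * exp ((1 - \<delta>) * t) / (1 - \<delta>)) has_real_derivative exp ((1 - \<delta>) * t) * l) (at t)"
    using \<delta>_less_1 by (auto intro!: derivative_eq_intros)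
  moreover have "min l (2 * exp (- t)) = l"
    using True exp_le_iff_kink[OF l, of t] by simp
  ultimately show ?thesis
    by (auto intro: has_field_derivative_transform_within_open[where S = "{..<- ln (l / 2)}"]
        simp: gap_primitive_def True)
next
  case False
  then have gt: "- ln (l / 2) < t" using t by simp
  have "((\<lambda>t. gap_mass l - 2 * exp (- \<delta> * t) / \<delta>) has_real_derivative 2 * exp (- \<delta> * t)) (at t)"
    using \<delta>_pos by (auto intro!: derivative_eq_intros)
  moreover have "exp ((1 - \<delta>) * t) * min l (2 * exp (- t)) = 2 * exp (- \<delta> * t)"
    using gt exp_le_iff_kink[OF l, of t] by (simp add: min_def algebra_simps flip: exp_add)
  ultimately show ?thesis
    using gt by (auto intro: has_field_derivative_transform_within_open[where S = "{- ln (l / 2)<..}"]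
        simp: gap_primitive_def)
qed

lemma gap_primitive_at_top:
  "((\<lambda>t. gap_primitive l t) \<longlongrightarrow> gap_mass l) at_top"
proof -
  have "((\<lambda>t. gap_mass l - 2 * exp (- \<delta> * t) / \<delta>) \<longlongrightarrow> gap_mass l - 2 * 0 / \<delta>) at_top"
    using \<delta>_pos by (intro tendsto_intros exp_tendsto_0) auto
  moreover have "eventually (\<lambda>t. gap_mass l - 2 * exp (- \<delta> * t) / \<delta> = gap_primitive l t) at_top"
    using eventually_gt_at_top[of "- ln (l / 2)"] by eventually_elim (simp add: gap_primitive_def)
  ultimately show ?thesis using Lim_transform_eventually by fastforce
qed

lemma exp_at_bot_0: "((\<lambda>t. exp ((1 - \<delta>) * t)) \<longlongrightarrow> 0) at_bot"
  using \<delta>_less_1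
  by (intro filterlim_compose[OF exp_at_bot] filterlim_tendsto_pos_mult_at_bot[OF tendsto_const]
      filterlim_ident) auto

lemma gap_primitive_at_bot:
  "((\<lambda>t. gap_primitive l t) \<longlongrightarrow> 0) at_bot"
proof -
  have "((\<lambda>t. l * exp ((1 - \<delta>) * t) / (1 - \<delta>)) \<longlongrightarrow> l * 0 / (1 - \<delta>)) at_bot"
    using \<delta>_less_1 by (intro tendsto_intros exp_at_bot_0) auto
  moreover have "eventually (\<lambda>t. l * exp ((1 - \<delta>) * t) / (1 - \<delta>) = gap_primitive l t) at_bot"
    using eventually_le_at_bot[of "- ln (l / 2)"] by eventually_elim (simp add: gap_primitive_def)
  ultimately show ?thesis using Lim_transform_eventually by fastforce
qed

definition total_mass :: real where
  "total_mass = (\<Sum>L\<in>G. gap_mass (len L))"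

text \<open>The derivative of the left-hand side is \<open>z\<close>, by the renewal equation, and both sides
  vanish at \<open>- \<infinity>\<close>.\<close>

lemma conserved_quantity:
  assumes B: "\<And>t. (B has_real_derivative f t) (at t)"
  shows "(\<Sum>j\<in>J. p j * (B t - B (t - s j))) = (\<Sum>L\<in>G. gap_primitive (len L) t)"
proof -
  define H where "H t = (\<Sum>j\<in>J. p j * (B t - B (t - s j))) - (\<Sum>L\<in>G. gap_primitive (len L) t)" for t
  have contB: "continuous_on UNIV B"
    using B by (auto intro!: continuous_at_imp_continuous_on dest: DERIV_isCont)
  have "continuous_on UNIV (\<lambda>t. B (t - s j))" for j
    by (rule continuous_on_compose2[OF contB]) (auto intro!: continuous_intros)
  then have contH: "continuous_on UNIV H"
    unfolding H_def using contB len_pos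
    by (intro continuous_intros) (auto intro: continuous_gap_primitive)
  have derivH: "(H has_derivative (\<lambda>h. 0)) (at t)" if "t \<notin> (\<lambda>L. - ln (len L / 2)) ` G" for t
  proof -
    have "((\<lambda>t. B (t - s j)) has_real_derivative f (t - s j)) (at t)" for j
      using DERIV_shift[of B "f (t - s j)" t "- s j"] B[of "t - s j"] by simp
    then have "(H has_real_derivative (\<Sum>j\<in>J. p j * (f t - f (t - s j)))
        - (\<Sum>L\<in>G. exp ((1 - \<delta>) * t) * min (len L) (2 * exp (- t)))) (at t)"
      unfolding H_def
      by (intro DERIV_diff DERIV_sum DERIV_cmult B has_derivative_gap_primitive len_pos)
        (use that in auto)
    also have "(\<Sum>L\<in>G. exp ((1 - \<delta>) * t) * min (len L) (2 * exp (- t))) = z t"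
      by (simp add: z_def g_def sum_distrib_left)
    also have "(\<Sum>j\<in>J. p j * (f t - f (t - s j))) = f t - (\<Sum>j\<in>J. p j * f (t - s j))"
      using p_sum by (simp add: right_diff_distrib sum_subtractf flip: sum_distrib_right)
    also have "\<dots> = z t" using f_rec[of t] by simp
    finally have "(H has_real_derivative 0) (at t)" by simp
    moreover have "(*) 0 = (\<lambda>h :: real. 0)" by auto
    ultimately show ?thesis by (simp add: has_field_derivative_def)
  qed
  \<comment> \<open>A continuous function whose derivative vanishes off the finitely many kinks is
    constant.\<close>
  have H_const: "H x = H y" for x y
    by (rule has_derivative_zero_unique_strong_convex[of UNIV "(\<lambda>L. - ln (len L / 2)) ` G" H y "H y" x])
      (use finite_G contH derivH in auto)
  have "(H \<longlongrightarrow> 0) at_bot"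
  proof -
    \<comment> \<open>Below \<open>t\<^sub>0\<close> the integrand is exactly
      \<open>w * exp ((1 - \<delta>) * t)\<close>, so increments over a step of fixed length tend to
      \<open>0\<close>.\<close>
    have "((\<lambda>t. B t - B (t - s j)) \<longlongrightarrow> 0) at_bot" if j: "j \<in> J" for j
    proof (rule Lim_null_comparison[of _ "\<lambda>t. s j * (w * exp ((1 - \<delta>) * t))"])
      show "eventually (\<lambda>t. norm (B t - B (t - s j)) \<le> s j * (w * exp ((1 - \<delta>) * t))) at_bot"
        using eventually_le_at_bot[of t\<^sub>0]
      proof eventually_elim
        case (elim t)
        obtain y where y: "t - s j < y" "y < t" "B t - B (t - s j) = s j * f y"
          using MVT2[of "t - s j" t B f] B s_pos[OF j] by auto
        have "f y = w * exp ((1 - \<delta>) * y)"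
          using y elim v_const[of y] by (simp add: f_def)
        also have "\<dots> \<le> w * exp ((1 - \<delta>) * t)"
          using y w_pos \<delta>_less_1 by simp
        finally show ?case using y(3) s_pos[OF j] f_pos[of y] by (simp add: abs_mult)
      qed
      show "((\<lambda>t. s j * (w * exp ((1 - \<delta>) * t))) \<longlongrightarrow> 0) at_bot"
        by (intro tendsto_mult_right_zero exp_at_bot_0)
    qed
    then have "(H \<longlongrightarrow> (\<Sum>j\<in>J. p j * 0) - (\<Sum>L\<in>G. 0)) at_bot"
      unfolding H_def by (intro tendsto_intros gap_primitive_at_bot) auto
    then show ?thesis by simp
  qed
  moreover have "((\<lambda>_. H t) \<longlongrightarrow> H t) at_bot" by simp
  moreover have "H = (\<lambda>_. H t)" using H_const by blast
  ultimately have "H t = 0"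
    by (metis tendsto_unique trivial_limit_at_bot_linorder)
  then show ?thesis by (simp add: H_def)
qed

lemma conserved_quantity_tendsto:
  assumes B: "\<And>t. (B has_real_derivative f t) (at t)"
  shows "((\<lambda>t. \<Sum>j\<in>J. p j * (B t - B (t - s j))) \<longlongrightarrow> total_mass) at_top"
  unfolding conserved_quantity[OF B] total_mass_def
  by (intro tendsto_intros gap_primitive_at_top)

section \<open>Convergence of averages, convergence and non-convergence of the solution\<close>

theorem average_tendsto:
  assumes B: "\<And>t. (B has_real_derivative f t) (at t)"
  shows "((\<lambda>t. B t / t) \<longlongrightarrow> total_mass / mean) at_top"
proof -
  \<comment> \<open>A linear function of slope \<open>c\<close> has averaged increment
    \<open>c * mean\<close>; this \<open>c\<close> matches the limit of the conserved quantity, so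
    the remainder \<open>D\<close> meets the hypothesis of \<open>sublinear\<close>.\<close>
  define c where "c = total_mass / mean"
  define D where "D t = B t - c * t" for t
  have "D t - (\<Sum>j\<in>J. p j * D (t - s j)) = (\<Sum>j\<in>J. p j * (B t - B (t - s j))) - total_mass" for t
  proof -
    have "(\<Sum>j\<in>J. p j * (D t - D (t - s j))) = (\<Sum>j\<in>J. p j * (B t - B (t - s j)) - c * (p j * s j))"
      by (rule sum.cong) (auto simp: D_def algebra_simps)
    also have "\<dots> = (\<Sum>j\<in>J. p j * (B t - B (t - s j))) - c * mean"
      by (simp add: sum_subtractf mean_def sum_distrib_left)
    also have "c * mean = total_mass" using mean_pos by (simp add: c_def)
    finally show ?thesis
      using p_sum by (simp add: right_diff_distrib sum_subtractf flip: sum_distrib_right)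
  qed
  then have "((\<lambda>t. D t - (\<Sum>j\<in>J. p j * D (t - s j))) \<longlongrightarrow> 0) at_top"
    using tendsto_diff[OF conserved_quantity_tendsto[OF B] tendsto_const[of total_mass]] by simp
  moreover have "bounded (D ` {a..b})" for a b
  proof -
    have "continuous_on {a..b} D"
      unfolding D_def using B
      by (intro continuous_intros continuous_at_imp_continuous_on) (auto dest: DERIV_isCont)
    then show ?thesis by (intro compact_imp_bounded compact_continuous_image) auto
  qed
  ultimately have "((\<lambda>t. D t / t) \<longlongrightarrow> 0) at_top" by (rule sublinear)
  then have lim: "((\<lambda>t. D t / t + c) \<longlongrightarrow> 0 + c) at_top" by (intro tendsto_intros)
  have "eventually (\<lambda>t. D t / t + c = B t / t) at_top"
    using eventually_gt_at_top[of 0] by eventually_elim (simp add: D_def field_simps)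
  from Lim_transform_eventually[OF lim this] show ?thesis by (simp add: c_def)
qed

theorem nonlattice_tendsto:
  assumes "\<And>\<eta>. \<eta> > 0 \<Longrightarrow>
      \<exists>u\<in>semigroup_hull (s ` J). \<exists>v\<in>semigroup_hull (s ` J). 0 < u - v \<and> u - v < \<eta>"
  shows "(f \<longlongrightarrow> total_mass / mean) at_top"
proof -
  obtain B where B: "\<And>t. (B has_real_derivative f t) (at t)" by (rule f_antiderivative) blast
  obtain C where C: "\<And>t. f t \<le> C" by (rule f_upper) blast
  have "\<bar>f t\<bar> \<le> C" for t using C[of t] f_pos[of t] by simp
  then show ?thesis
    using renewal_limit[OF B f_uniformly_continuous _ rec_tendsto conserved_quantity_tendsto[OF B] assms]
    by blast
qed

text \<open>On a kink-free interval, \<open>v\<close> is affine in \<open>\<epsilon> = exp (- t)\<close>; equivalently, on equally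
  spaced points it satisfies a recurrence with the characteristic roots \<open>1\<close> and \<open>exp (- h)\<close>.
  A function asymptotic to \<open>c * exp (- (1 - \<delta>) * t)\<close> with \<open>c \<noteq> 0\<close> does not.\<close>

theorem lattice_not_convergent:
  assumes a: "a > 0" and k: "\<And>j. j \<in> J \<Longrightarrow> s j = real (k j) * a"
  shows "\<not> (f \<longlongrightarrow> c) at_top"
proof
  assume lim: "(f \<longlongrightarrow> c) at_top"
  \<comment> \<open>\<open>\<theta> L\<close> is the position of the kink of \<open>L\<close> within
    its cell of length \<open>a\<close>, in units of \<open>a\<close>. Beyond the largest position
    \<open>x\<close> each cell is free of kinks; the inserted \<open>0\<close> keeps
    \<open>x\<close> nonnegative and the maximum defined.\<close>
  define \<theta> where "\<theta> L = frac (- ln (len L / 2) / a)" for L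
  define x where "x = Max (insert 0 (\<theta> ` G))"
  have x0: "0 \<le> x" and \<theta>_le: "\<And>L. L \<in> G \<Longrightarrow> \<theta> L \<le> x"
    using finite_G by (auto simp: x_def)
  have "x \<in> insert 0 (\<theta> ` G)" unfolding x_def using finite_G by (intro Max_in) auto
  then have x1: "x < 1" by (auto simp: \<theta>_def frac_lt_1)
  \<comment> \<open>Half the length of the kink-free part of a cell, so that \<open>t\<close>,
    \<open>t + h\<close> and \<open>t + 2 * h\<close> all fit into its closure.\<close>
  define h where "h = (1 - x) * a / 2"
  have h: "h > 0" using x1 a by (simp add: h_def)
  define q where "q = exp (- h)"
  define t\<^sub>1 where "t\<^sub>1 = x * a"
  \<comment> \<open>The difference operator that annihilates constants and \<open>exp (- t)\<close>,
    the two branches of a gap term.\<close>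
  define \<Delta> where "\<Delta> u t = u (t + 2 * h) - (1 + q) * u (t + h) + q * u t" for u t
  have exp_h: "exp (- (t + h)) = q * exp (- t)" "exp (- (t + 2 * h)) = q * (q * exp (- t))" for t
    by (simp_all add: q_def flip: exp_add)
  have \<Delta>_gap: "\<Delta> (\<lambda>t. min (len L) (2 * exp (- t))) (t\<^sub>1 + of_int n * a) = 0" if L: "L \<in> G" for L n
  proof -
    define \<kappa> where "\<kappa> = - ln (len L / 2)"
    define t where "t = t\<^sub>1 + of_int n * a"
    have "\<kappa> \<le> t \<or> t + 2 * h \<le> \<kappa>"
    proof (rule ccontr)
      assume "\<not> (\<kappa> \<le> t \<or> t + 2 * h \<le> \<kappa>)"
      moreover have "2 * h = a - x * a" by (simp add: h_def left_diff_distrib)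
      ultimately have "x * a + of_int n * a < \<kappa>" "\<kappa> < a + of_int n * a"
        by (auto simp: t_def t\<^sub>1_def)
      then have 1: "x + of_int n < \<kappa> / a" "\<kappa> / a < 1 + of_int n"
        using a by (simp_all add: field_simps)
      then have "\<lfloor>\<kappa> / a\<rfloor> = n" using x0 by (intro floor_unique) auto
      then have "\<theta> L > x" using 1 by (simp add: \<theta>_def \<kappa>_def frac_def)
      with \<theta>_le[OF L] show False by simp
    qed
    then show ?thesis
    proof
      assume "\<kappa> \<le> t"
      have m: "min (len L) (2 * exp (- u)) = 2 * exp (- u)" if "t \<le> u" for u
        using exp_le_iff_kink[OF len_pos[OF L], of u] \<open>\<kappa> \<le> t\<close> that
          len_pos[OF L]
        by (cases "u = \<kappa>") (auto simp: \<kappa>_def min_def)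
      have "t \<le> t + h" "t \<le> t + 2 * h" using h by simp_all
      show ?thesis
        unfolding t_def[symmetric] \<Delta>_def m[OF order.refl] m[OF \<open>t \<le> t + h\<close>]
          m[OF \<open>t \<le> t + 2 * h\<close>]
        unfolding exp_h
        by (simp add: algebra_simps)
    next
      assume "t + 2 * h \<le> \<kappa>"
      have m: "min (len L) (2 * exp (- u)) = len L" if "u \<le> t + 2 * h" for u
        using exp_le_iff_kink[OF len_pos[OF L], of u] \<open>t + 2 * h \<le> \<kappa>\<close> that
        by (auto simp: \<kappa>_def)
      have "t \<le> t + 2 * h" "t + h \<le> t + 2 * h" using h by simp_all
      show ?thesis
        unfolding t_def[symmetric] \<Delta>_def m[OF order.refl] m[OF \<open>t \<le> t + 2 * h\<close>]
          m[OF \<open>t + h \<le> t + 2 * h\<close>]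
        by (simp add: algebra_simps)
    qed
  qed
  \<comment> \<open>The steps are multiples of \<open>a\<close>, so the recursion never leaves the
    points \<open>t\<^sub>1 + n * a\<close>. The induction starts at
    \<open>t\<^sub>0 - 2 * h\<close> so that all three sample points lie where \<open>v\<close> is
    constant.\<close>
  have \<Delta>_v: "(\<exists>n. t = t\<^sub>1 + of_int n * a) \<longrightarrow> \<Delta> v t = 0" for t
  proof (induction t rule: renewal_induct[of "t\<^sub>0 - 2 * h"])
    case (1 t)
    then show ?case using h v_const by (simp add: \<Delta>_def algebra_simps)
  next
    case (2 t)
    show ?case
    proof
      assume "\<exists>n. t = t\<^sub>1 + of_int n * a"
      then obtain n where n: "t = t\<^sub>1 + of_int n * a" by blast
      have "\<Delta> v (t - s j) = 0" if j: "j \<in> J" for j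
      proof -
        have "t - s j = t\<^sub>1 + of_int (n - int (k j)) * a"
          using n k[OF j] by (simp add: algebra_simps)
        then show ?thesis using 2(2)[OF j] by blast
      qed
      moreover have "\<Delta> g t = 0"
      proof -
        have "\<Delta> g t = (\<Sum>L\<in>G. \<Delta> (\<lambda>t. min (len L) (2 * exp (- t))) t)"
          by (simp add: \<Delta>_def g_def sum_subtractf sum.distrib sum_distrib_left)
        then show ?thesis using \<Delta>_gap n by simp
      qed
      moreover have "\<Delta> v t = (\<Sum>j\<in>J. r j * \<Delta> v (t - s j)) + \<Delta> g t"
      proof -
        have "(\<Sum>j\<in>J. r j * \<Delta> v (t - s j)) = (\<Sum>j\<in>J. r j * v (t + 2 * h - s j))
            - (1 + q) * (\<Sum>j\<in>J. r j * v (t + h - s j)) + q * (\<Sum>j\<in>J. r j * v (t - s j))"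
          by (simp add: \<Delta>_def sum_distrib_left sum_subtractf sum.distrib algebra_simps)
        then show ?thesis
          unfolding \<Delta>_def[of v t] \<Delta>_def[of g t] v_rec[of t] v_rec[of "t + h"] v_rec[of "t + 2 * h"]
          by (simp add: algebra_simps)
      qed
      ultimately show "\<Delta> v t = 0" by simp
    qed
  qed
  \<comment> \<open>The growth of the weight \<open>exp ((1 - \<delta>) * t)\<close> over a length
    \<open>h\<close>; it turns the recurrence for \<open>v\<close> into one for
    \<open>f\<close>.\<close>
  define y where "y = exp ((1 - \<delta>) * h)"
  have f_eq: "f (t + 2 * h) - (1 + q) * y * f (t + h) + q * y * y * f t = 0"
    if "t = t\<^sub>1 + of_int n * a" for t n
  proof -
    have "exp ((1 - \<delta>) * (t + h)) = y * exp ((1 - \<delta>) * t)"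
      "exp ((1 - \<delta>) * (t + 2 * h)) = y * y * exp ((1 - \<delta>) * t)"
      by (simp_all add: y_def algebra_simps flip: exp_add)
    then have "f (t + 2 * h) - (1 + q) * y * f (t + h) + q * y * y * f t
        = y * y * exp ((1 - \<delta>) * t) * \<Delta> v t"
      by (simp add: f_def \<Delta>_def algebra_simps)
    then show ?thesis using \<Delta>_v[of t] that by auto
  qed
  have top: "filterlim (\<lambda>n. t\<^sub>1 + real n * a + d) at_top sequentially" for d
  proof -
    have "filterlim (\<lambda>n. real n * a) at_top sequentially"
      using a by (intro filterlim_at_top_mult_tendsto_pos[OF tendsto_const _ filterlim_real_sequentially])
    then have "filterlim (\<lambda>n. (t\<^sub>1 + d) + real n * a) at_top sequentially"
      by (intro filterlim_tendsto_add_at_top[OF tendsto_const])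
    then show ?thesis by (simp add: add_ac)
  qed
  have "(\<lambda>n. f (t\<^sub>1 + real n * a + 2 * h) - (1 + q) * y * f (t\<^sub>1 + real n * a + h)
      + q * y * y * f (t\<^sub>1 + real n * a + 0)) \<longlonglongrightarrow> c - (1 + q) * y * c + q * y * y * c"
    by (intro tendsto_intros filterlim_compose[OF lim top])
  moreover have "f (t\<^sub>1 + real n * a + 2 * h) - (1 + q) * y * f (t\<^sub>1 + real n * a + h)
      + q * y * y * f (t\<^sub>1 + real n * a + 0) = 0" for n
    using f_eq[of _ "int n"] by simp
  ultimately have "c - (1 + q) * y * c + q * y * y * c = 0"
    by (simp add: LIMSEQ_const_iff)
  \<comment> \<open>Since \<open>y > 1\<close> by \<open>\<delta> < 1\<close> and
    \<open>q * y = exp (- \<delta> * h) < 1\<close> by \<open>\<delta> > 0\<close>, neither factor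
    vanishes. So \<open>c = 0\<close>, against the positive lower bound on \<open>f\<close>.\<close>
  then have "c * ((1 - y) * (1 - q * y)) = 0" by (simp add: algebra_simps)
  moreover have "y > 1" using h \<delta>_less_1 by (simp add: y_def)
  moreover have "q * y < 1" using h \<delta>_pos by (simp add: q_def y_def algebra_simps flip: exp_add)
  ultimately have "c = 0" by simp
  obtain c' where c': "c' > 0" "\<And>t. t \<ge> t\<^sub>0 \<Longrightarrow> c' \<le> f t" by (rule f_lower) blast
  then have "c' \<le> c"
    by (intro tendsto_lowerbound[OF lim]) (auto simp: eventually_at_top_linorder)
  with \<open>c = 0\<close> c' show False by simp
qed

end

section \<open>Self-similar sets on an interval\<close>

lemma component_open_bounded_real:
  fixes U L :: "real set"
  assumes "open U" "bounded U" "L \<in> components U"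
  obtains a b where "a < b" "L = {a<..<b}" "a \<notin> U" "b \<notin> U"
proof -
  define a b where "a = Inf L" and "b = Sup L"
  have L: "open L" "connected L" "L \<noteq> {}" "L \<subseteq> U"
    using assms in_components_connected[of L U] in_components_nonempty[of L U]
      in_components_subset[of L U] by (auto intro: open_components)
  then have "bounded L" using bounded_subset[OF assms(2)] by blast
  then have bdd: "bdd_above L" "bdd_below L"
    by (auto intro: bounded_imp_bdd_above bounded_imp_bdd_below)
  have "a < x \<and> x < b" if x: "x \<in> L" for x
  proof -
    obtain e where e: "e > 0" "\<And>y. \<bar>y - x\<bar> < e \<Longrightarrow> y \<in> L"
      using L(1) x unfolding open_dist dist_real_def by blast
    have "x - e / 2 \<in> L" "x + e / 2 \<in> L" using e by auto
    then have "a \<le> x - e / 2" "x + e / 2 \<le> b"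
      unfolding a_def b_def using bdd by (auto intro: cInf_lower cSup_upper)
    then show ?thesis using e(1) by linarith
  qed
  moreover have "x \<in> L" if x: "a < x" "x < b" for x
  proof -
    obtain y z where "y \<in> L" "y < x" "z \<in> L" "x < z"
      using x L(3) unfolding a_def b_def by (meson cInf_lessD less_cSupD)
    then show ?thesis
      using L(2) unfolding is_interval_connected_1[symmetric] is_interval_1 by (meson less_imp_le)
  qed
  ultimately have eq: "L = {a<..<b}" by auto
  then have ab: "a < b" using L(3) by auto
  \<comment> \<open>If an endpoint belonged to \<open>U\<close>, adding it to \<open>L\<close> would
    give a larger connected subset of \<open>U\<close>.\<close>
  have "a \<notin> U"
  proof
    assume "a \<in> U"
    then have "{a..<b} \<subseteq> U" using L(4) eq by (auto simp: le_less)
    then have "{a..<b} \<subseteq> L"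
      using components_maximal[OF assms(3), of "{a..<b}"] eq L(3) by fastforce
    then show False using ab eq by auto
  qed
  moreover have "b \<notin> U"
  proof
    assume "b \<in> U"
    then have "{a<..b} \<subseteq> U" using L(4) eq by (auto simp: le_less)
    then have "{a<..b} \<subseteq> L"
      using components_maximal[OF assms(3), of "{a<..b}"] eq L(3) by fastforce
    then show False using ab eq by auto
  qed
  ultimately show ?thesis using that ab eq by blast
qed

text \<open>The distances from \<open>f x\<close> to \<open>f A\<close> and to \<open>f B\<close>
  add up to the distance between these two, which leaves one position for \<open>f x\<close>. The
  order of \<open>f A\<close> and \<open>f B\<close> decides the sign of the slope.\<close>

lemma similarity_on_interval_affine:
  fixes f :: "real \<Rightarrow> real"
  assumes "similarity_on {A..B} c f" "A < B" "c \<ge> 0"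
  obtains m b where "\<bar>m\<bar> = c" "\<And>x. x \<in> {A..B} \<Longrightarrow> f x = m * x + b"
proof -
  have sim: "\<bar>f x - f y\<bar> = c * \<bar>x - y\<bar>" if "x \<in> {A..B}" "y \<in> {A..B}" for x y
    using assms(1) that by (auto simp: similarity_on_def dist_real_def)
  define m where "m = (if f A \<le> f B then c else - c)"
  have "f x = m * x + (f A - m * A)" if x: "x \<in> {A..B}" for x
  proof -
    have "\<bar>f x - f A\<bar> = c * x - c * A" "\<bar>f B - f x\<bar> = c * B - c * x" "\<bar>f B - f A\<bar> = c * B - c * A"
      using sim[of x A] sim[of B x] sim[of B A] x assms(2) by (auto simp: right_diff_distrib)
    moreover have "c * A \<le> c * x" "c * x \<le> c * B" using x assms(3) by (auto intro: mult_left_mono)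
    ultimately show ?thesis
      unfolding m_def by (cases "f A \<le> f B") (auto simp: abs_if split: if_splits)
  qed
  moreover have "\<bar>m\<bar> = c" using assms(3) by (simp add: m_def)
  ultimately show ?thesis using that by blast
qed

lemma measure_lborel_affine_image:
  fixes m b :: real
  assumes "S \<in> sets borel" "(\<lambda>x. m * x + b) ` S \<in> sets borel"
  shows "measure lborel ((\<lambda>x. m * x + b) ` S) = \<bar>m\<bar> * measure lborel S"
  using measure_lebesgue_affine[of m b S] assms by simp

lemma measure_Un_fmeasurable:
  assumes "A \<in> fmeasurable M" "B \<in> fmeasurable M" "A \<inter> B = {}"
  shows "measure M (A \<union> B) = measure M A + measure M B"
  using measure_Un2[OF assms(1,2)] assms(3) by (simp add: Diff_triv inf_commute)

text \<open>For neighbouring pieces that share an endpoint: finite overlaps are negligible, and on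
  compact sets the two versions of Lebesgue measure agree.\<close>

lemma measure_lborel_finite_Union:
  assumes "finite I" and "\<And>i. i \<in> I \<Longrightarrow> compact (f i)"
    and "\<And>i j. i \<in> I \<Longrightarrow> j \<in> I \<Longrightarrow> i \<noteq> j \<Longrightarrow> finite (f i \<inter> f j)"
  shows "measure lborel (\<Union>i\<in>I. f i :: real set) = (\<Sum>i\<in>I. measure lborel (f i))"
proof -
  have "measure lebesgue (\<Union>i\<in>I. f i) = (\<Sum>i\<in>I. measure lebesgue (f i))"
    using assms
    by (intro measure_negligible_finite_Union_image)
      (auto simp: pairwise_def intro: negligible_finite lmeasurable_compact)
  moreover have "measure lebesgue (f i) = measure lborel (f i)" if "i \<in> I" for i
    using borel_compact[OF assms(2)[OF that]] by simp
  moreover have "compact (\<Union>i\<in>I. f i)" using assms(1,2) by (intro compact_UN)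
  then have "(\<Union>i\<in>I. f i) \<in> sets borel" by (rule borel_compact)
  then have "measure lebesgue (\<Union>i\<in>I. f i) = measure lborel (\<Union>i\<in>I. f i)"
    by simp
  ultimately show ?thesis by simp
qed

locale interval_ifs =
  fixes X F :: "real set" and N :: nat and \<phi> :: "nat \<Rightarrow> real \<Rightarrow> real" and r :: "nat \<Rightarrow> real"
  assumes ifs: "similarity_ifs X N \<phi> r"
    and attractor: "self_similar_set X N \<phi> F"
    and osc: "feasible_open_set N \<phi> (interior X)"
    and null: "emeasure lborel F = 0"
begin

lemma N_ge: "2 \<le> N"
  using ifs by (simp add: similarity_ifs_def)

lemma r_bounds: "i \<in> {1..N} \<Longrightarrow> 0 < r i" "i \<in> {1..N} \<Longrightarrow> r i < 1"
  using ifs by (auto simp: similarity_ifs_def)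

lemma X_interval:
  obtains A B where "X = {A..B}" "A < B" "interior X = {A<..<B}"
proof -
  obtain A B where X: "X = {A..B}"
    using ifs connected_compact_interval_1[of X]
    by (auto simp: similarity_ifs_def is_interval_connected_1)
  moreover have "A < B"
    using osc unfolding X feasible_open_set_def by auto
  ultimately show ?thesis using that by simp
qed

lemma affine:
  obtains m b where "\<And>i. i \<in> {1..N} \<Longrightarrow> \<bar>m i\<bar> = r i"
    "\<And>i x. i \<in> {1..N} \<Longrightarrow> x \<in> X \<Longrightarrow> \<phi> i x = m i * x + b i"
proof -
  obtain A B where X: "X = {A..B}" "A < B" by (rule X_interval) blast
  have "\<exists>m b. \<bar>m\<bar> = r i \<and> (\<forall>x\<in>X. \<phi> i x = m * x + b)" if i: "i \<in> {1..N}" for i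
  proof -
    have "similarity_on {A..B} (r i) (\<phi> i)" "0 \<le> r i"
      using ifs i unfolding X similarity_ifs_def by (auto intro: less_imp_le)
    from similarity_on_interval_affine[OF this(1) X(2) this(2)]
    show ?thesis unfolding X by metis
  qed
  then show ?thesis using that by metis
qed

lemma F_facts: "F \<subseteq> X" "F \<noteq> {}" "compact F" "F = (\<Union>i\<in>{1..N}. \<phi> i ` F)"
  using attractor by (simp_all add: self_similar_set_def)

section \<open>The convex hull of the attractor and its images\<close>

definition c where "c = Inf F"
definition d where "d = Sup F"

lemma F_ends: "c \<in> F" "d \<in> F" "F \<subseteq> {c..d}"
proof -
  have "closed F" "bdd_above F" "bdd_below F"
    using F_facts by (auto intro: compact_imp_closed bounded_imp_bdd_above
        bounded_imp_bdd_below compact_imp_bounded)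
  then show "c \<in> F" "d \<in> F" "F \<subseteq> {c..d}"
    unfolding c_def d_def using F_facts
    by (auto intro: closed_contains_Inf closed_contains_Sup cInf_lower cSup_upper)
qed

lemma hull_F: "convex hull F = {c..d}"
proof
  show "convex hull F \<subseteq> {c..d}"
    using F_ends by (intro hull_minimal) auto
  have mem: "c \<in> convex hull F" "d \<in> convex hull F" by (intro hull_inc F_ends)+
  have "is_interval (convex hull F)"
    using is_interval_convex_1 convex_convex_hull by blast
  then show "{c..d} \<subseteq> convex hull F"
    unfolding is_interval_1 using mem by (meson atLeastAtMost_iff subsetI)
qed

lemma hull_subset_X: "{c..d} \<subseteq> X"
proof -
  obtain A B where "X = {A..B}" by (rule X_interval) blast
  then show ?thesis using F_ends F_facts(1) by auto
qed

lemma \<phi>_dist: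
  assumes "i \<in> {1..N}" "x \<in> {c..d}" "y \<in> {c..d}"
  shows "dist (\<phi> i x) (\<phi> i y) = r i * dist x y"
proof -
  have "x \<in> X" "y \<in> X" using assms hull_subset_X by auto
  then show ?thesis using ifs assms(1) by (simp add: similarity_ifs_def similarity_on_def)
qed

text \<open>If \<open>F\<close> were a point, all maps would fix it. The images of the interior of
  \<open>X\<close> under two of them would then overlap at this point, or next to it if it is an
  endpoint of \<open>X\<close>, against the open set condition.\<close>

lemma c_less_d: "c < d"
proof (rule ccontr)
  assume "\<not> c < d"
  moreover have "c \<le> d" using F_ends by auto
  ultimately have F: "x = c" if "x \<in> F" for x using F_ends that by fastforce
  obtain A B where X: "X = {A..B}" "A < B" "interior X = {A<..<B}" by (rule X_interval) blast
  obtain m b where m: "\<And>i. i \<in> {1..N} \<Longrightarrow> \<bar>m i\<bar> = r i"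
    and mb: "\<And>i x. i \<in> {1..N} \<Longrightarrow> x \<in> X \<Longrightarrow> \<phi> i x = m i * x + b i"
    by (rule affine) blast
  have c: "c \<in> {A..B}" using F_ends F_facts X by auto
  have fixed: "\<phi> i c = c" if "i \<in> {1..N}" for i
    using F_facts(4) F_ends(1) that by (intro F) blast
  have \<phi>_eq: "\<phi> i x = c + m i * (x - c)" if "i \<in> {1..N}" "x \<in> {A..B}" for i x
    using mb[OF that(1), of x] mb[OF that(1), of c] fixed[OF that(1)] that c X(1)
    by (simp add: algebra_simps)
  have maps: "\<phi> i x \<in> {A..B}" if "i \<in> {1..N}" "x \<in> {A..B}" for i x
    using ifs that unfolding similarity_ifs_def X by blast
  have 12: "1 \<in> {1..N}" "2 \<in> {1..N}" using N_ge by auto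
  have disj: "\<phi> 1 ` {A<..<B} \<inter> \<phi> 2 ` {A<..<B} = {}"
    using osc 12 unfolding feasible_open_set_def X(3) by auto
  have overlap: False
    if "x \<in> {A<..<B}" "y \<in> {A<..<B}" "m 1 * (x - c) = m 2 * (y - c)" for x y
  proof -
    have "\<phi> 1 x = \<phi> 2 y"
      using that \<phi>_eq[OF 12(1), of x] \<phi>_eq[OF 12(2), of y] by simp
    then have "\<phi> 1 x \<in> \<phi> 1 ` {A<..<B} \<inter> \<phi> 2 ` {A<..<B}" using that(1,2) by blast
    then show False using disj by blast
  qed
  consider "A < c" "c < B" | "c = A" | "c = B" using c by force
  then show False
  proof cases
    case 1
    then show ?thesis using overlap[of c c] by simp
  next
    case 2
    \<comment> \<open>A map that fixes an endpoint of \<open>X\<close> and reverses orientation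
      would leave \<open>X\<close>.\<close>
    have pos: "m i = r i" if i: "i \<in> {1..N}" for i
    proof (rule ccontr)
      assume "m i \<noteq> r i"
      then have "m i < 0" using m[OF i] r_bounds[OF i] by auto
      then have "m i * (B - c) < 0" using X(2) 2 by (simp add: mult_neg_pos)
      then show False using maps[OF i, of B] \<phi>_eq[OF i, of B] X(2) 2 by auto
    qed
    \<comment> \<open>\<open>A + h * r 2\<close> under \<open>\<phi> 1\<close> and
      \<open>A + h * r 1\<close> under \<open>\<phi> 2\<close> have the common image
      \<open>A + h * r 1 * r 2\<close>; this \<open>h\<close> keeps both points inside
      \<open>X\<close>. The case of the right endpoint is symmetric.\<close>
    define h where "h = (B - A) / 2"
    have h: "0 < h" "h < B - A" using X(2) by (auto simp: h_def)
    have hr: "0 < h * r i" "h * r i < B - A" if "i \<in> {1..N}" for i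
      using h r_bounds[OF that] mult_strict_mono[of h "B - A" "r i" 1] by auto
    then show ?thesis
      using overlap[of "A + h * r 2" "A + h * r 1"] hr[OF 12(1)] hr[OF 12(2)] pos[OF 12(1)] pos[OF 12(2)] 2
      by simp
  next
    case 3
    have pos: "m i = r i" if i: "i \<in> {1..N}" for i
    proof (rule ccontr)
      assume "m i \<noteq> r i"
      then have "m i < 0" using m[OF i] r_bounds[OF i] by auto
      then have "m i * (A - c) > 0" using X(2) 3 by (simp add: mult_neg_neg)
      then show False using maps[OF i, of A] \<phi>_eq[OF i, of A] X(2) 3 by auto
    qed
    define h where "h = (B - A) / 2"
    have h: "0 < h" "h < B - A" using X(2) by (auto simp: h_def)
    have hr: "0 < h * r i" "h * r i < B - A" if "i \<in> {1..N}" for i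
      using h r_bounds[OF that] mult_strict_mono[of h "B - A" "r i" 1] by auto
    then show ?thesis
      using overlap[of "B - h * r 2" "B - h * r 1"] hr[OF 12(1)] hr[OF 12(2)] pos[OF 12(1)] pos[OF 12(2)] 3
      by simp
  qed
qed

definition lo where "lo i = min (\<phi> i c) (\<phi> i d)"
definition hi where "hi i = max (\<phi> i c) (\<phi> i d)"

lemma lo_hi_in_F: "i \<in> {1..N} \<Longrightarrow> lo i \<in> \<phi> i ` F" "i \<in> {1..N} \<Longrightarrow> hi i \<in> \<phi> i ` F"
  using F_ends by (auto simp: lo_def hi_def min_def max_def)

lemma image_subset_F: "i \<in> {1..N} \<Longrightarrow> \<phi> i ` F \<subseteq> F"
  using F_facts(4) by blast

lemma pieces:
  assumes i: "i \<in> {1..N}"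
  shows "\<phi> i ` {c..d} = {lo i..hi i}" "\<phi> i ` {c<..<d} = {lo i<..<hi i}" "lo i < hi i"
proof -
  obtain m b where m: "\<And>i. i \<in> {1..N} \<Longrightarrow> \<bar>m i\<bar> = r i"
    and mb: "\<And>i x. i \<in> {1..N} \<Longrightarrow> x \<in> X \<Longrightarrow> \<phi> i x = m i * x + b i"
    by (rule affine) blast
  have eq: "\<phi> i x = m i * x + b i" if "x \<in> {c..d}" for x
    using mb[OF i] that hull_subset_X by blast
  have m0: "m i \<noteq> 0" using m[OF i] r_bounds[OF i] by auto
  have imgs: "\<phi> i ` {c..d} = (\<lambda>x. m i * x + b i) ` {c..d}"
    "\<phi> i ` {c<..<d} = (\<lambda>x. m i * x + b i) ` {c<..<d}"
    using eq by (auto intro!: image_cong)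
  have ends: "\<phi> i c = m i * c + b i" "\<phi> i d = m i * d + b i"
    using eq c_less_d by auto
  show "lo i < hi i"
  proof -
    have "\<phi> i c \<noteq> \<phi> i d" using m0 c_less_d unfolding ends by simp
    then show ?thesis by (auto simp: lo_def hi_def min_def max_def)
  qed
  have surj: "x = m i * ((x - b i) / m i) + b i" for x using m0 by simp
  show "\<phi> i ` {c..d} = {lo i..hi i}"
  proof (cases "m i > 0")
    case True
    then have "lo i = m i * c + b i" "hi i = m i * d + b i"
      using c_less_d ends by (auto simp: lo_def hi_def)
    moreover have "(\<lambda>x. m i * x + b i) ` {c..d} = {m i * c + b i..m i * d + b i}"
    proof (intro equalityI subsetI)
      fix x assume "x \<in> {m i * c + b i..m i * d + b i}"
      then have "(x - b i) / m i \<in> {c..d}" using True by (auto simp: field_simps)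
      then show "x \<in> (\<lambda>x. m i * x + b i) ` {c..d}" using surj by blast
    qed (use True in auto)
    ultimately show ?thesis using imgs by simp
  next
    case False
    then have neg: "m i < 0" using m0 by simp
    then have "lo i = m i * d + b i" "hi i = m i * c + b i"
      using c_less_d ends by (auto simp: lo_def hi_def)
    moreover have "(\<lambda>x. m i * x + b i) ` {c..d} = {m i * d + b i..m i * c + b i}"
    proof (intro equalityI subsetI)
      fix x assume "x \<in> {m i * d + b i..m i * c + b i}"
      then have "(x - b i) / m i \<in> {c..d}" using neg by (auto simp: field_simps)
      then show "x \<in> (\<lambda>x. m i * x + b i) ` {c..d}" using surj by blast
    qed (use neg in \<open>auto intro: mult_left_mono_neg\<close>)
    ultimately show ?thesis using imgs by simp
  qed
  have inj: "inj_on (\<phi> i) {c..d}"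
    using m0 eq by (auto intro!: inj_onI)
  have "{c<..<d} = {c..d} - {c, d}" by auto
  then have "\<phi> i ` {c<..<d} = \<phi> i ` {c..d} - \<phi> i ` {c, d}"
    using inj c_less_d by (simp add: inj_on_image_set_diff[of "\<phi> i" "{c..d}"])
  also have "\<dots> = {lo i..hi i} - {lo i, hi i}"
    using \<open>\<phi> i ` {c..d} = {lo i..hi i}\<close> by (auto simp: lo_def hi_def min_def max_def)
  also have "\<dots> = {lo i<..<hi i}" by auto
  finally show "\<phi> i ` {c<..<d} = {lo i<..<hi i}" .
qed

text \<open>The open set condition separates the open pieces, since the open hull lies in the
  interior of \<open>X\<close>. Closed pieces may still touch at endpoints, hence the mixed
  form.\<close>

lemma pieces_disjoint:
  assumes "i \<in> {1..N}" "j \<in> {1..N}" "i \<noteq> j"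
  shows "{lo i..hi i} \<inter> {lo j<..<hi j} = {}"
proof -
  obtain A B where X: "X = {A..B}" "interior X = {A<..<B}" by (rule X_interval) blast
  have "{c<..<d} \<subseteq> interior X" using hull_subset_X c_less_d unfolding X by auto
  then have disj: "{lo i<..<hi i} \<inter> {lo j<..<hi j} = {}"
    using osc assms unfolding feasible_open_set_def
      pieces(2)[OF assms(1), symmetric] pieces(2)[OF assms(2), symmetric] by blast
  have "hi i \<le> lo j \<or> hi j \<le> lo i"
  proof (rule ccontr)
    assume "\<not> ?thesis"
    then have lt: "max (lo i) (lo j) < min (hi i) (hi j)"
      using pieces(3)[OF assms(1)] pieces(3)[OF assms(2)] by auto
    obtain x where "max (lo i) (lo j) < x" "x < min (hi i) (hi j)"
      using dense[OF lt] by blast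
    then show False using disj by auto
  qed
  then show ?thesis by auto
qed

text \<open>A point of \<open>F\<close> in the open piece lies in no other image, and the two
  endpoints of the piece are themselves images of \<open>c\<close> and \<open>d\<close>.\<close>

lemma F_piece:
  assumes i: "i \<in> {1..N}"
  shows "F \<inter> {lo i..hi i} = \<phi> i ` F"
proof
  show "\<phi> i ` F \<subseteq> F \<inter> {lo i..hi i}"
    using image_subset_F[OF i] pieces(1)[OF i] F_ends(3) by blast
  show "F \<inter> {lo i..hi i} \<subseteq> \<phi> i ` F"
  proof
    fix x assume x: "x \<in> F \<inter> {lo i..hi i}"
    show "x \<in> \<phi> i ` F"
    proof (cases "x \<in> {lo i<..<hi i}")
      case True
      obtain j where j: "j \<in> {1..N}" "x \<in> \<phi> j ` F" using x F_facts(4) by blast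
      then have "x \<in> {lo j..hi j}" using pieces(1)[OF j(1)] F_ends(3) by blast
      then have "j = i" using pieces_disjoint[OF j(1) i] True by blast
      then show ?thesis using j by blast
    next
      case False
      then have "x = lo i \<or> x = hi i" using x by auto
      then show ?thesis using lo_hi_in_F[OF i] by auto
    qed
  qed
qed

lemma infdist_F:
  obtains y where "y \<in> F" "infdist x F = dist x y"
  using infdist_attains_inf[of F x] F_facts compact_imp_closed by blast

text \<open>The endpoints of a piece belong to \<open>\<phi> i\<close>
  F\<open>, so points of\<close>F\<open>outside the piece are never closer than these. The distance
  to\<close>F\<open>is thus the distance to\<close>\<phi> i \<open>F\<close>, which scales by
  \<open>r i\<close>.\<close>

lemma infdist_piece:
  assumes i: "i \<in> {1..N}" and u: "u \<in> {c..d}"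
  shows "infdist (\<phi> i u) F = r i * infdist u F"
proof (rule antisym)
  obtain y where y: "y \<in> F" "infdist u F = dist u y" by (rule infdist_F)
  have "infdist (\<phi> i u) F \<le> dist (\<phi> i u) (\<phi> i y)"
    using image_subset_F[OF i] y by (intro infdist_le) auto
  also have "\<dots> = r i * infdist u F"
    using \<phi>_dist[OF i u] y F_ends(3) by auto
  finally show "infdist (\<phi> i u) F \<le> r i * infdist u F" .
next
  obtain y where y: "y \<in> F" "infdist (\<phi> i u) F = dist (\<phi> i u) y" by (rule infdist_F)
  have img: "\<phi> i u \<in> {lo i..hi i}" using pieces(1)[OF i] u by blast
  define y' where "y' = max (lo i) (min (hi i) y)"
  have "y' \<in> \<phi> i ` F"
  proof (cases "y \<in> {lo i..hi i}")
    case True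
    then show ?thesis using F_piece[OF i] y(1) by (auto simp: y'_def)
  next
    case False
    then have "y' = lo i \<or> y' = hi i" using pieces(3)[OF i] by (auto simp: y'_def)
    then show ?thesis using lo_hi_in_F[OF i] by auto
  qed
  then obtain w where w: "w \<in> F" "y' = \<phi> i w" by blast
  have "r i * infdist u F \<le> r i * dist u w"
    using r_bounds[OF i] w(1) by (intro mult_left_mono infdist_le) auto
  also have "\<dots> = dist (\<phi> i u) y'"
    using \<phi>_dist[OF i u, of w] w F_ends(3) by auto
  also have "\<dots> \<le> dist (\<phi> i u) y"
    using img by (auto simp: y'_def dist_real_def)
  finally show "r i * infdist u F \<le> infdist (\<phi> i u) F" using y by simp
qed

section \<open>The primary gaps\<close>

definition K where "K = (\<Union>i\<in>{1..N}. {lo i..hi i})"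

lemma K_facts: "closed K" "F \<subseteq> K" "K \<subseteq> {c..d}"
proof -
  show "closed K" unfolding K_def by (intro closed_UN) auto
  show "F \<subseteq> K"
    unfolding K_def using F_facts(4) F_piece by blast
  have "lo i \<in> {c..d}" "hi i \<in> {c..d}" if "i \<in> {1..N}" for i
    using lo_hi_in_F[OF that] image_subset_F[OF that] F_ends(3) by blast+
  then show "K \<subseteq> {c..d}" unfolding K_def by fastforce
qed

definition U where "U = {c..d} - K"

lemma U_facts: "open U" "bounded U"
proof -
  have "U = {c<..<d} - K" using K_facts(2) F_ends by (auto simp: U_def le_less)
  then show "open U" using K_facts(1) by (simp add: open_Diff)
  show "bounded U" by (rule bounded_subset[of "{c..d}"]) (auto simp: U_def)
qed

lemma gaps_eq: "primary_gaps N \<phi> F = components U"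
proof -
  have "(\<Union>i\<in>{1..N}. \<phi> i ` {c..d}) = K" unfolding K_def using pieces(1) by simp
  then show ?thesis unfolding primary_gaps_def hull_F U_def by simp
qed

text \<open>The ends of a gap lie in \<open>K\<close>. A piece containing such an end cannot reach
  into the gap, so it ends there, and endpoints of pieces are in \<open>F\<close>.\<close>

lemma gap_interval:
  assumes "L \<in> primary_gaps N \<phi> F"
  obtains a b where "a < b" "L = {a<..<b}" "a \<in> F" "b \<in> F" "a \<in> hi ` {1..N}"
    "L \<subseteq> {c..d}" "L \<inter> K = {}"
proof -
  have L: "L \<in> components U" using assms gaps_eq by simp
  then obtain a b where ab: "a < b" "L = {a<..<b}" "a \<notin> U" "b \<notin> U"
    using component_open_bounded_real[OF U_facts L] by blast
  have sub: "L \<subseteq> U" using L in_components_subset by blast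
  then have LU: "L \<subseteq> {c..d}" "L \<inter> K = {}" by (auto simp: U_def)
  have "closure L \<subseteq> {c..d}" using LU(1) by (intro closure_minimal) auto
  then have "{a..b} \<subseteq> {c..d}" using ab by simp
  then have K: "a \<in> K" "b \<in> K" using ab by (auto simp: U_def)
  obtain i where i: "i \<in> {1..N}" "a \<in> {lo i..hi i}" using K(1) by (auto simp: K_def)
  have "a = hi i"
  proof (rule ccontr)
    assume "a \<noteq> hi i"
    then have lt: "a < min (hi i) b" using i ab by auto
    obtain x where x: "a < x" "x < min (hi i) b" using dense[OF lt] by blast
    then have "x \<in> L" "x \<in> {lo i..hi i}" using ab i by auto
    then show False using LU(2) i(1) unfolding K_def by blast
  qed
  obtain j where j: "j \<in> {1..N}" "b \<in> {lo j..hi j}" using K(2) by (auto simp: K_def)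
  have "b = lo j"
  proof (rule ccontr)
    assume "b \<noteq> lo j"
    then have lt: "max (lo j) a < b" using j ab by auto
    obtain x where x: "max (lo j) a < x" "x < b" using dense[OF lt] by blast
    then have "x \<in> L" "x \<in> {lo j..hi j}" using ab j by auto
    then show False using LU(2) j(1) unfolding K_def by blast
  qed
  show ?thesis
    using that[OF ab(1,2)] \<open>a = hi i\<close> \<open>b = lo j\<close> i j LU lo_hi_in_F image_subset_F by blast
qed

text \<open>Disjoint open intervals have different left ends, and each left end of a gap is the
  right end of one of the \<open>N\<close> pieces.\<close>

lemma finite_gaps: "finite (primary_gaps N \<phi> F)"
proof (rule inj_on_finite[of Inf _ "hi ` {1..N}"])
  show "Inf ` primary_gaps N \<phi> F \<subseteq> hi ` {1..N}"
  proof
    fix x assume "x \<in> Inf ` primary_gaps N \<phi> F"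
    then obtain L where L: "L \<in> primary_gaps N \<phi> F" "x = Inf L" by blast
    obtain a b where "a < b" "L = {a<..<b}" "a \<in> hi ` {1..N}" using gap_interval[OF L(1)] by metis
    then show "x \<in> hi ` {1..N}" using L(2) by simp
  qed
  show "inj_on Inf (primary_gaps N \<phi> F)"
  proof (rule inj_onI)
    fix L M assume L: "L \<in> primary_gaps N \<phi> F" and M: "M \<in> primary_gaps N \<phi> F" and eq: "Inf L = Inf M"
    obtain a b where ab: "a < b" "L = {a<..<b}" using gap_interval[OF L] by metis
    obtain a' b' where ab': "a' < b'" "M = {a'<..<b'}" using gap_interval[OF M] by metis
    have "a = a'" using eq ab ab' by simp
    moreover obtain x where "a < x" "x < min b b'" using dense[of a "min b b'"] ab ab' \<open>a = a'\<close> by auto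
    ultimately have "x \<in> L \<inter> M" using ab ab' by auto
    then show "L = M"
      using L M pairwise_disjoint_components[of U] unfolding gaps_eq pairwise_def by blast
  qed
qed simp

section \<open>Volume of the parallel set and its recursion\<close>

definition V where "V \<epsilon> = measure lborel {x\<in>{c..d}. infdist x F \<le> \<epsilon>}"

lemma closed_infdist_le: "closed {x. infdist x F \<le> \<epsilon>}"
  by (intro closed_Collect_le continuous_intros)

text \<open>Outside the hull only the extreme points \<open>c\<close> and \<open>d\<close> matter,
  which adds an interval of length \<epsilon> on either side.\<close>

lemma parallel_volume_eq:
  assumes "\<epsilon> > 0"
  shows "parallel_volume F \<epsilon> = 2 * \<epsilon> + V \<epsilon>"
proof -
  have outside: "infdist x F \<le> \<epsilon> \<longleftrightarrow> c - \<epsilon> \<le> x \<and> x \<le> d + \<epsilon>" if "x \<notin> {c..d}" for x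
  proof
    assume "infdist x F \<le> \<epsilon>"
    moreover obtain y where "y \<in> F" "infdist x F = dist x y" by (rule infdist_F)
    ultimately show "c - \<epsilon> \<le> x \<and> x \<le> d + \<epsilon>"
      using F_ends(3) that by (auto simp: dist_real_def abs_le_iff)
  next
    assume "c - \<epsilon> \<le> x \<and> x \<le> d + \<epsilon>"
    then have "dist x c \<le> \<epsilon> \<or> dist x d \<le> \<epsilon>" using that by (auto simp: dist_real_def)
    then show "infdist x F \<le> \<epsilon>"
      using infdist_le[OF F_ends(1), of x] infdist_le[OF F_ends(2), of x] by linarith
  qed
  define S where "S = {x\<in>{c..d}. infdist x F \<le> \<epsilon>}"
  have S_eq: "S = {c..d} \<inter> {x. infdist x F \<le> \<epsilon>}" by (auto simp: S_def)
  have meas: "S \<in> fmeasurable lborel"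
    unfolding S_eq by (intro fmeasurable_compact compact_Int_closed closed_infdist_le) auto
  have eq: "parallel_set F \<epsilon> = (S \<union> {c - \<epsilon>..<c}) \<union> {d<..d + \<epsilon>}"
    unfolding parallel_set_def S_def using outside assms c_less_d by fastforce
  have fm: "{c - \<epsilon>..<c} \<in> fmeasurable lborel" "{d<..d + \<epsilon>} \<in> fmeasurable lborel"
    by (auto intro!: fmeasurableI simp: assms less_imp_le)
  have "measure lborel (parallel_set F \<epsilon>) = measure lborel (S \<union> {c - \<epsilon>..<c}) + measure lborel {d<..d + \<epsilon>}"
    unfolding eq using c_less_d meas fm by (intro measure_Un_fmeasurable) (auto simp: S_def)
  also have "measure lborel (S \<union> {c - \<epsilon>..<c}) = measure lborel S + measure lborel {c - \<epsilon>..<c}"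
    using meas fm by (intro measure_Un_fmeasurable) (auto simp: S_def)
  finally show ?thesis
    using assms unfolding parallel_volume_def V_def S_def by simp
qed

text \<open>Both ends of the gap are in \<open>F\<close> and nothing between them is. The parallel
  set fills a collar of length \<epsilon> at each end, and the whole gap once the collars
  meet.\<close>

lemma V_gap:
  assumes "L \<in> primary_gaps N \<phi> F" "\<epsilon> > 0"
  shows "measure lborel {x\<in>L. infdist x F \<le> \<epsilon>} = min (measure lborel L) (2 * \<epsilon>)"
proof -
  obtain a b where ab: "a < b" "L = {a<..<b}" "a \<in> F" "b \<in> F" "L \<inter> K = {}"
    using gap_interval[OF assms(1)] by metis
  have dist_eq: "infdist x F = min (x - a) (b - x)" if "x \<in> L" for x
  proof (rule antisym)
    show "infdist x F \<le> min (x - a) (b - x)"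
      using infdist_le[OF ab(3), of x] infdist_le[OF ab(4), of x] that ab by (auto simp: dist_real_def)
    obtain y where y: "y \<in> F" "infdist x F = dist x y" by (rule infdist_F)
    have "y \<notin> L" using y K_facts(2) ab(5) by blast
    then show "min (x - a) (b - x) \<le> infdist x F"
      using y that ab by (auto simp: dist_real_def)
  qed
  show ?thesis
  proof (cases "b - a \<le> 2 * \<epsilon>")
    case True
    then have "{x\<in>L. infdist x F \<le> \<epsilon>} = L" using dist_eq by (auto simp: min_le_iff_disj ab(2))
    then show ?thesis using True ab by simp
  next
    case False
    then have eq: "{x\<in>L. infdist x F \<le> \<epsilon>} = {a<..a + \<epsilon>} \<union> {b - \<epsilon>..<b}"
      using dist_eq assms(2) by (auto simp: min_le_iff_disj ab(2))
    have "measure lborel ({a<..a + \<epsilon>} \<union> {b - \<epsilon>..<b})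
        = measure lborel {a<..a + \<epsilon>} + measure lborel {b - \<epsilon>..<b}"
      using False assms(2)
      by (intro measure_Un_fmeasurable) (auto intro!: fmeasurableI)
    then show ?thesis unfolding eq using False ab assms(2) by simp
  qed
qed

lemma V_piece:
  assumes i: "i \<in> {1..N}"
  shows "measure lborel {x\<in>{lo i..hi i}. infdist x F \<le> \<epsilon>} = r i * V (\<epsilon> / r i)"
proof -
  obtain m b where m: "\<And>i. i \<in> {1..N} \<Longrightarrow> \<bar>m i\<bar> = r i"
    and mb: "\<And>i x. i \<in> {1..N} \<Longrightarrow> x \<in> X \<Longrightarrow> \<phi> i x = m i * x + b i"
    by (rule affine) blast
  define S where "S = {x\<in>{c..d}. infdist x F \<le> \<epsilon> / r i}"
  have "{x\<in>{lo i..hi i}. infdist x F \<le> \<epsilon>} = \<phi> i ` S"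
    unfolding pieces(1)[OF i, symmetric] S_def
    using infdist_piece[OF i] r_bounds[OF i] by (auto simp: field_simps)
  also have "\<dots> = (\<lambda>x. m i * x + b i) ` S"
    using mb[OF i] hull_subset_X by (intro image_cong) (auto simp: S_def)
  finally have eq: "{x\<in>{lo i..hi i}. infdist x F \<le> \<epsilon>} = (\<lambda>x. m i * x + b i) ` S" .
  have "S = {c..d} \<inter> {x. infdist x F \<le> \<epsilon> / r i}" by (auto simp: S_def)
  then have "compact S" by (simp add: compact_Int_closed closed_infdist_le)
  moreover from this have "compact ((\<lambda>x. m i * x + b i) ` S)"
    by (intro compact_continuous_image continuous_intros)
  ultimately show ?thesis
    unfolding eq V_def S_def[symmetric] using m[OF i]
    by (subst measure_lborel_affine_image) (auto intro: borel_compact)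
qed

lemma V_recursion:
  assumes "\<epsilon> > 0"
  shows "V \<epsilon> = (\<Sum>i\<in>{1..N}. r i * V (\<epsilon> / r i))
    + (\<Sum>L\<in>primary_gaps N \<phi> F. min (measure lborel L) (2 * \<epsilon>))"
proof -
  define P where "P i = {x\<in>{lo i..hi i}. infdist x F \<le> \<epsilon>}" for i
  define Q where "Q L = {x\<in>L. infdist x F \<le> \<epsilon>}" for L
  have P_compact: "compact (P i)" for i
  proof -
    have "P i = {lo i..hi i} \<inter> {x. infdist x F \<le> \<epsilon>}" by (auto simp: P_def)
    then show ?thesis by (simp add: compact_Int_closed closed_infdist_le)
  qed
  have Q_meas: "Q L \<in> fmeasurable lborel" if L: "L \<in> primary_gaps N \<phi> F" for L
  proof -
    obtain a b where ab: "a < b" "L = {a<..<b}" using gap_interval[OF L] by metis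
    then have "Q L = {a<..<b} \<inter> {x. infdist x F \<le> \<epsilon>}" by (auto simp: Q_def)
    moreover have "{a<..<b} \<in> fmeasurable lborel" using ab by (intro fmeasurableI) auto
    ultimately show ?thesis
      using closed_infdist_le by (auto intro!: fmeasurable_Int_fmeasurable)
  qed
  have P_Un: "(\<Union>i\<in>{1..N}. P i) = {x\<in>K. infdist x F \<le> \<epsilon>}"
    unfolding P_def K_def by blast
  have "\<Union>(primary_gaps N \<phi> F) = U" unfolding gaps_eq by simp
  then have Q_Un: "(\<Union>L\<in>primary_gaps N \<phi> F. Q L) = {x\<in>U. infdist x F \<le> \<epsilon>}"
    unfolding Q_def by blast
  have "{x\<in>{c..d}. infdist x F \<le> \<epsilon>}
      = (\<Union>i\<in>{1..N}. P i) \<union> (\<Union>L\<in>primary_gaps N \<phi> F. Q L)"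
    unfolding P_Un Q_Un U_def using K_facts(3) by blast
  moreover have "(\<Union>i\<in>{1..N}. P i) \<inter> (\<Union>L\<in>primary_gaps N \<phi> F. Q L) = {}"
    unfolding P_Un Q_Un U_def by blast
  moreover have "(\<Union>i\<in>{1..N}. P i) \<in> fmeasurable lborel"
    using P_compact by (intro fmeasurable_compact compact_UN) auto
  moreover have "(\<Union>L\<in>primary_gaps N \<phi> F. Q L) \<in> fmeasurable lborel"
    using finite_gaps Q_meas by (intro fmeasurable.finite_UN) auto
  ultimately have "V \<epsilon> = measure lborel (\<Union>i\<in>{1..N}. P i)
      + measure lborel (\<Union>L\<in>primary_gaps N \<phi> F. Q L)"
    unfolding V_def by (simp add: measure_Un_fmeasurable)
  also have "measure lborel (\<Union>i\<in>{1..N}. P i) = (\<Sum>i\<in>{1..N}. measure lborel (P i))"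
  proof (intro measure_lborel_finite_Union P_compact)
    fix i j assume ij: "i \<in> {1..N}" "j \<in> {1..N}" "i \<noteq> j"
    \<comment> \<open>Distinct pieces share at most endpoints, so the overlaps have measure
      zero.\<close>
    have "P i \<inter> P j \<subseteq> {lo j, hi j}"
      using pieces_disjoint[OF ij] unfolding P_def by (auto simp: le_less)
    then show "finite (P i \<inter> P j)" by (rule finite_subset) simp
  qed simp
  also have "\<dots> = (\<Sum>i\<in>{1..N}. r i * V (\<epsilon> / r i))"
    unfolding P_def by (intro sum.cong V_piece) auto
  also have "measure lborel (\<Union>L\<in>primary_gaps N \<phi> F. Q L)
      = (\<Sum>L\<in>primary_gaps N \<phi> F. measure lborel (Q L))"
  proof (intro measure_UNION' finite_gaps Q_meas)
    show "pairwise (\<lambda>L M. disjnt (Q L) (Q M)) (primary_gaps N \<phi> F)"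
      using pairwise_disjoint_components[of U] unfolding gaps_eq Q_def pairwise_def disjnt_def by blast
  qed
  also have "\<dots> = (\<Sum>L\<in>primary_gaps N \<phi> F. min (measure lborel L) (2 * \<epsilon>))"
    unfolding Q_def by (intro sum.cong V_gap assms) auto
  finally show ?thesis .
qed

lemma V_const:
  assumes "d - c \<le> \<epsilon>"
  shows "V \<epsilon> = d - c"
proof -
  have "infdist x F \<le> \<epsilon>" if "x \<in> {c..d}" for x
    using infdist_le[OF F_ends(1), of x] that assms by (simp add: dist_real_def)
  then have "{x\<in>{c..d}. infdist x F \<le> \<epsilon>} = {c..d}" by blast
  then show ?thesis unfolding V_def using c_less_d by simp
qed

section \<open>Existence of gaps and the Moran exponent\<close>

lemma gap_pos:
  assumes L: "L \<in> primary_gaps N \<phi> F"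
  shows "0 < measure lborel L"
proof -
  obtain a b where "a < b" "L = {a<..<b}" using gap_interval[OF L] by metis
  then show ?thesis by simp
qed

text \<open>Without gaps every point of the hull lies in a piece, so the bound on the distance to
  \<open>F\<close> shrinks by the factor \<open>\<rho>\<close> per level. The hull would then be
  contained in the null set \<open>F\<close>.\<close>

lemma gaps_nonempty: "primary_gaps N \<phi> F \<noteq> {}"
proof
  assume "primary_gaps N \<phi> F = {}"
  then have "U = {}" using gaps_eq Union_components[of U] by simp
  then have cover: "{c..d} \<subseteq> K" by (auto simp: U_def)
  define \<rho> where "\<rho> = Max (r ` {1..N})"
  have \<rho>: "r i \<le> \<rho>" if "i \<in> {1..N}" for i using that by (simp add: \<rho>_def)
  have "\<rho> \<in> r ` {1..N}" unfolding \<rho>_def using N_ge by (intro Max_in) auto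
  then have \<rho>01: "0 < \<rho>" "\<rho> < 1" using r_bounds by auto
  have decay: "\<forall>x\<in>{c..d}. infdist x F \<le> (d - c) * \<rho> ^ n" for n
  proof (induction n)
    case 0
    have "infdist x F \<le> d - c" if "x \<in> {c..d}" for x
      using infdist_le[OF F_ends(1), of x] that by (simp add: dist_real_def)
    then show ?case by simp
  next
    case (Suc n)
    show ?case
    proof
      fix x assume "x \<in> {c..d}"
      then obtain i where i: "i \<in> {1..N}" "x \<in> {lo i..hi i}" using cover by (auto simp: K_def)
      then obtain u where u: "u \<in> {c..d}" "x = \<phi> i u" using pieces(1)[OF i(1)] by blast
      have "infdist x F = r i * infdist u F" using infdist_piece[OF i(1) u(1)] u by simp
      also have "\<dots> \<le> \<rho> * ((d - c) * \<rho> ^ n)"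
        using Suc u(1) \<rho>[OF i(1)] \<rho>01 by (intro mult_mono) (auto simp: infdist_nonneg)
      finally show "infdist x F \<le> (d - c) * \<rho> ^ Suc n" by (simp add: mult_ac)
    qed
  qed
  have "{c..d} \<subseteq> F"
  proof
    fix x assume x: "x \<in> {c..d}"
    have "(\<lambda>n. (d - c) * \<rho> ^ n) \<longlonglongrightarrow> (d - c) * 0"
      using \<rho>01 by (intro tendsto_intros LIMSEQ_power_zero) auto
    then have "infdist x F \<le> (d - c) * 0"
      using decay x by (intro tendsto_lowerbound) auto
    then have "infdist x F = 0" using infdist_nonneg[of x F] by simp
    then show "x \<in> F"
      using F_facts(2,3) in_closed_iff_infdist_zero[of F x] compact_imp_closed by blast
  qed
  then have "emeasure lborel {c..d} \<le> emeasure lborel F"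
    using F_facts(3) by (intro emeasure_mono) (auto intro: borel_compact)
  then show False using null c_less_d by simp
qed

text \<open>Evaluated at \<open>\<epsilon> = d - c\<close>, all volumes in the recursion equal
  \<open>d - c\<close>, and the gap sum is positive.\<close>

lemma sum_r_less_1: "(\<Sum>i\<in>{1..N}. r i) < 1"
proof -
  have pos: "0 < d - c" using c_less_d by simp
  have "V ((d - c) / r i) = d - c" if i: "i \<in> {1..N}" for i
  proof (rule V_const)
    have "(d - c) * r i \<le> (d - c) * 1" using pos r_bounds[OF i] by (intro mult_left_mono) auto
    then show "d - c \<le> (d - c) / r i" using r_bounds[OF i] by (simp add: pos_le_divide_eq)
  qed
  then have "(\<Sum>i\<in>{1..N}. r i * V ((d - c) / r i)) = (\<Sum>i\<in>{1..N}. r i) * (d - c)"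
    by (simp add: sum_distrib_right)
  moreover have "0 < (\<Sum>L\<in>primary_gaps N \<phi> F. min (measure lborel L) (2 * (d - c)))"
  proof (rule sum_pos[OF finite_gaps gaps_nonempty])
    fix L assume "L \<in> primary_gaps N \<phi> F"
    from gap_pos[OF this] pos show "0 < min (measure lborel L) (2 * (d - c))" by simp
  qed
  ultimately have "(\<Sum>i\<in>{1..N}. r i) * (d - c) < 1 * (d - c)"
    using V_recursion[OF pos] V_const[of "d - c"] by simp
  then show ?thesis using pos by (simp only: mult_less_cancel_right_pos)
qed

text \<open>The sum of \<open>r i powr x\<close> is \<open>N > 1\<close> at \<open>x = 0\<close> and
  less than \<open>1\<close> at \<open>x = 1\<close>; the intermediate value theorem gives a root
  strictly between.\<close>

lemma moran_exponent:
  obtains \<delta> where "0 < \<delta>" "\<delta> < 1" "(\<Sum>i\<in>{1..N}. r i powr \<delta>) = 1"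
proof -
  define h where "h x = (\<Sum>i\<in>{1..N}. r i powr x)" for x
  have "r i powr 0 = 1" "r i powr 1 = r i" if "i \<in> {1..N}" for i
    using r_bounds(1)[OF that] by simp_all
  then have "h 0 = (\<Sum>i\<in>{1..N}. 1)" "h 1 = (\<Sum>i\<in>{1..N}. r i)"
    unfolding h_def by (auto intro!: sum.cong)
  then have h0: "h 0 > 1" and h1: "h 1 < 1" using N_ge sum_r_less_1 by simp_all
  have "continuous_on {0..1} h"
    unfolding h_def by (intro continuous_intros) (use r_bounds in force)
  then obtain x where x: "0 \<le> x" "x \<le> 1" "h x = 1"
    using IVT2'[of h 1 1 0] h0 h1 by auto
  then have "x \<noteq> 0" "x \<noteq> 1" using h0 h1 by auto
  with x show ?thesis using that[of x] unfolding h_def by simp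
qed

end

section \<open>Minkowski content\<close>

lemma filterlim_minus_ln_at_right_0: "filterlim (\<lambda>\<epsilon> :: real. - ln \<epsilon>) at_top (at_right 0)"
  by (rule filterlim_compose[OF filterlim_uminus_at_top_at_bot ln_at_0])

lemma filterlim_exp_minus_at_top: "filterlim (\<lambda>t :: real. exp (- t)) (at_right 0) at_top"
  unfolding filterlim_at
  by (auto intro!: always_eventually filterlim_compose[OF exp_at_bot filterlim_uminus_at_bot_at_top])

text \<open>Here \<delta> is a root of the Moran equation; that it is the Minkowski dimension is
  derived from the bounds on the renewal solution.\<close>

locale interval_ifs_moran = interval_ifs +
  fixes \<delta> :: real
  assumes delta_pos: "0 < \<delta>" and delta_less_1: "\<delta> < 1"
    and moran: "(\<Sum>i\<in>{1..N}. r i powr \<delta>) = 1"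
begin

definition v :: "real \<Rightarrow> real" where "v t = V (exp (- t))"

sublocale R: gap_recursion "{1..N}" r "primary_gaps N \<phi> F" "measure lborel" v "d - c" "- ln (d - c)" \<delta>
proof
  show "2 \<le> card {1..N}" using N_ge by simp
  show "v t = d - c" if "t \<le> - ln (d - c)" for t
  proof -
    have "exp (ln (d - c)) \<le> exp (- t)" using that by simp
    then show ?thesis unfolding v_def using c_less_d by (intro V_const) simp
  qed
  show "v t = (\<Sum>j\<in>{1..N}. r j * v (t + ln (r j)))
      + (\<Sum>L\<in>primary_gaps N \<phi> F. min (measure lborel L) (2 * exp (- t)))" for t
  proof -
    have "v (t + ln (r j)) = V (exp (- t) / r j)" if "j \<in> {1..N}" for j
    proof -
      have "exp (- (t + ln (r j))) = exp (- t - ln (r j))" by simp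
      also have "\<dots> = exp (- t) / r j" unfolding exp_diff using r_bounds[OF that] by simp
      finally show ?thesis unfolding v_def by simp
    qed
    then show ?thesis using V_recursion[of "exp (- t)"] by (simp add: v_def[of t])
  qed
qed (use r_bounds delta_pos delta_less_1 moran finite_gaps gap_pos c_less_d in auto)

text \<open>The function whose limits are the Minkowski contents, in the variable
  \<open>t = - ln \<epsilon>\<close>. The summand \<open>2 * exp (- \<delta> * t)\<close> comes from
  the two collars outside the hull and vanishes in the limit.\<close>

definition rescaled :: "real \<Rightarrow> real" where
  "rescaled t = R.f t + 2 * exp (- \<delta> * t)"

lemma rescaled_eq:
  assumes "\<epsilon> > 0"
  shows "\<epsilon> powr (\<delta> - 1) * parallel_volume F \<epsilon> = rescaled (- ln \<epsilon>)"
proof -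
  have "R.f (- ln \<epsilon>) = \<epsilon> powr (\<delta> - 1) * V \<epsilon>"
    using assms by (simp add: R.f_def v_def powr_def algebra_simps)
  moreover have "\<epsilon> powr (\<delta> - 1) * (2 * \<epsilon>) = 2 * exp (- \<delta> * (- ln \<epsilon>))"
    using assms by (simp add: powr_diff) (simp add: powr_def)
  ultimately show ?thesis
    using assms by (simp add: parallel_volume_eq rescaled_def distrib_left)
qed

lemma rescaled_bounds:
  obtains k C where "k > 0" "eventually (\<lambda>t. k \<le> rescaled t \<and> rescaled t \<le> C) at_top"
proof -
  obtain k where k: "k > 0" "\<And>t. t \<ge> - ln (d - c) \<Longrightarrow> k \<le> R.f t" by (rule R.f_lower) blast
  obtain C where C: "\<And>t. R.f t \<le> C" by (rule R.f_upper) blast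
  have "eventually (\<lambda>t. k \<le> rescaled t \<and> rescaled t \<le> C + 2) at_top"
    using eventually_ge_at_top[of "- ln (d - c)"] eventually_ge_at_top[of 0]
  proof eventually_elim
    case (elim t)
    have "exp (- \<delta> * t) \<le> 1" "0 \<le> exp (- \<delta> * t)" using elim delta_pos by simp_all
    then show ?case using k(2)[OF elim(1)] C[of t] unfolding rescaled_def by linarith
  qed
  with k(1) that show ?thesis by blast
qed

text \<open>The parallel volume is \<open>\<epsilon> powr (1 - \<delta>)\<close> times a factor
  between two positive constants, whose logarithm is negligible against
  \<open>ln \<epsilon>\<close>.\<close>

lemma minkowski_dim_eq: "minkowski_dim F = \<delta>"
proof -
  obtain k C where kC: "k > 0" "eventually (\<lambda>t. k \<le> rescaled t \<and> rescaled t \<le> C) at_top"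
    by (rule rescaled_bounds)
  have ev: "eventually (\<lambda>t. norm (ln (rescaled t) * inverse t) \<le> max \<bar>ln k\<bar> \<bar>ln C\<bar> * \<bar>inverse t\<bar>) at_top"
    using kC(2)
  proof eventually_elim
    case (elim t)
    then have "ln k \<le> ln (rescaled t)" "ln (rescaled t) \<le> ln C" using kC(1) by simp_all
    then have "\<bar>ln (rescaled t)\<bar> \<le> max \<bar>ln k\<bar> \<bar>ln C\<bar>" by linarith
    then show ?case unfolding real_norm_def abs_mult by (rule mult_right_mono) simp
  qed
  have "((\<lambda>t. inverse t :: real) \<longlongrightarrow> 0) at_top"
    by (rule tendsto_inverse_0_at_top[OF filterlim_ident])
  then have "((\<lambda>t. max \<bar>ln k\<bar> \<bar>ln C\<bar> * \<bar>inverse t\<bar>) \<longlongrightarrow> 0) at_top"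
    by (intro tendsto_mult_right_zero tendsto_rabs_zero)
  with ev have "((\<lambda>t. ln (rescaled t) * inverse t) \<longlongrightarrow> 0) at_top"
    by (rule Lim_null_comparison)
  then have "((\<lambda>t. (1 - \<delta>) - ln (rescaled t) * inverse t) \<longlongrightarrow> (1 - \<delta>) - 0) at_top"
    by (intro tendsto_intros)
  then have lim: "((\<lambda>\<epsilon>. (1 - \<delta>) - ln (rescaled (- ln \<epsilon>)) * inverse (- ln \<epsilon>)) \<longlongrightarrow> 1 - \<delta>) (at_right 0)"
    using filterlim_compose[OF _ filterlim_minus_ln_at_right_0] by force
  have "eventually (\<lambda>\<epsilon>. k \<le> rescaled (- ln \<epsilon>)) (at_right 0)"
    using eventually_compose_filterlim[OF kC(2) filterlim_minus_ln_at_right_0]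
    by eventually_elim simp
  moreover have "eventually (\<lambda>\<epsilon> :: real. 0 < \<epsilon> \<and> \<epsilon> < 1) (at_right 0)"
    unfolding eventually_at_right_field by (intro exI[of _ 1]) simp
  ultimately have "eventually (\<lambda>\<epsilon>. (1 - \<delta>) - ln (rescaled (- ln \<epsilon>)) * inverse (- ln \<epsilon>)
      = ln (parallel_volume F \<epsilon>) / ln \<epsilon>) (at_right 0)"
  proof eventually_elim
    case (elim \<epsilon>)
    have "parallel_volume F \<epsilon> = \<epsilon> powr (1 - \<delta>) * (\<epsilon> powr (\<delta> - 1) * parallel_volume F \<epsilon>)"
      using elim(2) by (simp add: mult.assoc[symmetric] flip: powr_add)
    also have "\<dots> = \<epsilon> powr (1 - \<delta>) * rescaled (- ln \<epsilon>)" using elim(2) by (simp add: rescaled_eq)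
    finally have "ln (parallel_volume F \<epsilon>) = (1 - \<delta>) * ln \<epsilon> + ln (rescaled (- ln \<epsilon>))"
      using elim kC(1) by (simp add: ln_mult ln_powr)
    moreover have "ln \<epsilon> \<noteq> 0" using elim(2) by simp
    ultimately show ?case by (simp add: field_simps)
  qed
  from Lim_transform_eventually[OF lim this]
  have "Lim (at_right 0) (\<lambda>\<epsilon>. ln (parallel_volume F \<epsilon>) / ln \<epsilon>) = 1 - \<delta>"
    by (intro tendsto_Lim) auto
  then show ?thesis by (simp add: minkowski_dim_def)
qed

section \<open>The average content\<close>

abbreviation average where "average \<equiv> R.total_mass / R.mean"

lemma average_eq:
  "average = 2 powr (1 - \<delta>) * (\<Sum>L\<in>primary_gaps N \<phi> F. measure lborel L powr \<delta>) /
     ((\<delta> - 1) * \<delta> * (\<Sum>i\<in>{1..N}. ln (r i) * r i powr \<delta>))"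
proof -
  have "R.total_mass = 2 powr (1 - \<delta>) * (\<Sum>L\<in>primary_gaps N \<phi> F. measure lborel L powr \<delta>) / (\<delta> * (1 - \<delta>))"
    unfolding R.total_mass_def R.gap_mass_def by (simp add: sum_distrib_left sum_divide_distrib)
  moreover have "R.mean = - (\<Sum>i\<in>{1..N}. ln (r i) * r i powr \<delta>)"
    unfolding R.mean_def R.p_def R.s_def by (simp add: sum_negf mult.commute)
  moreover have "(\<delta> - 1) * \<delta> * S = \<delta> * (1 - \<delta>) * - S" for S :: real by (simp add: algebra_simps)
  ultimately show ?thesis by (simp only: divide_divide_eq_left)
qed

lemma average_content: "has_average_minkowski_content F average"
proof -
  obtain B where B: "\<And>t. (B has_real_derivative R.f t) (at t)" by (rule R.f_antiderivative) blast
  \<comment> \<open>\<open>h (- ln T)\<close> is the averaged integral expressed through the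
    primitive \<open>B\<close>; every term other than \<open>B t / t\<close> vanishes in the
    limit.\<close>
  define h where "h t = B t / t + (2 / \<delta> - B 0 - 2 * exp (- \<delta> * t) / \<delta>) * inverse t" for t
  have "(h \<longlongrightarrow> average + (2 / \<delta> - B 0 - 2 * 0 / \<delta>) * 0) at_top"
    unfolding h_def
    by (intro tendsto_intros R.average_tendsto B R.exp_tendsto_0 tendsto_inverse_0_at_top[OF filterlim_ident])
      (use delta_pos in auto)
  then have lim: "((\<lambda>T. h (- ln T)) \<longlongrightarrow> average) (at_right 0)"
    using filterlim_compose[OF _ filterlim_minus_ln_at_right_0] by force
  have "eventually (\<lambda>T. h (- ln T) = inverse \<bar>ln T\<bar> *
      integral {T..1} (\<lambda>\<epsilon>. \<epsilon> powr (\<delta> - 2) * parallel_volume F \<epsilon>)) (at_right 0)"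
    unfolding eventually_at_right_field
  proof (intro exI[of _ 1] conjI allI impI)
    fix T :: real assume T: "0 < T" "T < 1"
    \<comment> \<open>The substitution \<open>t = - ln \<epsilon>\<close> yields
      \<open>- B (- ln \<epsilon>)\<close>, and the outer collars of total length
      \<open>2 * \<epsilon>\<close> yield the power of \<epsilon>.\<close>
    define \<Phi> where "\<Phi> \<epsilon> = 2 * \<epsilon> powr \<delta> / \<delta> - B (- ln \<epsilon>)" for \<epsilon>
    have "((\<lambda>\<epsilon>. \<epsilon> powr (\<delta> - 2) * parallel_volume F \<epsilon>) has_integral \<Phi> 1 - \<Phi> T) {T..1}"
    proof (rule fundamental_theorem_of_calculus)
      fix x assume x: "x \<in> {T..1}"
      then have x0: "x > 0" using T by auto
      have "((\<lambda>\<epsilon>. B (- ln \<epsilon>)) has_real_derivative R.f (- ln x) * (- (1 / x))) (at x)"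
        using x0 by (intro DERIV_chain2[OF B]) (auto intro!: derivative_eq_intros)
      then have "(\<Phi> has_real_derivative 2 * x powr (\<delta> - 1) + R.f (- ln x) / x) (at x)"
        unfolding \<Phi>_def[abs_def] using x0 delta_pos
        by (auto intro!: derivative_eq_intros simp: powr_diff)
      moreover have "2 * x powr (\<delta> - 1) + R.f (- ln x) / x = x powr (\<delta> - 2) * parallel_volume F x"
      proof -
        have "x powr (\<delta> - 2) * parallel_volume F x = rescaled (- ln x) / x"
          unfolding rescaled_eq[OF x0, symmetric] using x0 by (simp add: powr_diff power2_eq_square)
        also have "\<dots> = 2 * x powr (\<delta> - 1) + R.f (- ln x) / x"
          using x0 by (simp add: rescaled_def add_divide_distrib powr_diff) (simp add: powr_def)
        finally show ?thesis ..
      qed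
      ultimately show "(\<Phi> has_vector_derivative x powr (\<delta> - 2) * parallel_volume F x) (at x within {T..1})"
        by (simp add: has_real_derivative_iff_has_vector_derivative has_vector_derivative_at_within)
    qed (use T in simp)
    then have "integral {T..1} (\<lambda>\<epsilon>. \<epsilon> powr (\<delta> - 2) * parallel_volume F \<epsilon>) = \<Phi> 1 - \<Phi> T"
      by (rule integral_unique)
    moreover have "\<Phi> 1 - \<Phi> T = B (- ln T) + (2 / \<delta> - B 0 - 2 * exp (- \<delta> * (- ln T)) / \<delta>)"
      using T by (simp add: \<Phi>_def powr_def)
    ultimately show "h (- ln T) = inverse \<bar>ln T\<bar> *
        integral {T..1} (\<lambda>\<epsilon>. \<epsilon> powr (\<delta> - 2) * parallel_volume F \<epsilon>)"
      using T by (simp only: h_def) (simp add: distrib_left divide_inverse mult.commute)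
  qed simp
  from Lim_transform_eventually[OF lim this] show ?thesis
    unfolding has_average_minkowski_content_def minkowski_dim_eq .
qed

lemma average_minkowski_content_eq: "average_minkowski_content F = average"
  unfolding average_minkowski_content_def
proof (rule the_equality)
  show "has_average_minkowski_content F average" by (rule average_content)
  show "m = average" if "has_average_minkowski_content F m" for m
    using that average_content unfolding has_average_minkowski_content_def
    by (intro tendsto_unique[OF trivial_limit_at_right_real])
qed

section \<open>Upper and lower content in the nonlattice and the lattice case\<close>

lemma contents_eq:
  "upper_minkowski_content F = Limsup (at_right 0) (\<lambda>\<epsilon>. ereal (rescaled (- ln \<epsilon>)))"
  "lower_minkowski_content F = Liminf (at_right 0) (\<lambda>\<epsilon>. ereal (rescaled (- ln \<epsilon>)))"
proof -
  have "eventually (\<lambda>\<epsilon>. ereal (\<epsilon> powr (\<delta> - 1) * parallel_volume F \<epsilon>)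
      = ereal (rescaled (- ln \<epsilon>))) (at_right 0)"
    using eventually_at_right_less[of 0] by eventually_elim (simp add: rescaled_eq)
  then show "upper_minkowski_content F = Limsup (at_right 0) (\<lambda>\<epsilon>. ereal (rescaled (- ln \<epsilon>)))"
    "lower_minkowski_content F = Liminf (at_right 0) (\<lambda>\<epsilon>. ereal (rescaled (- ln \<epsilon>)))"
    unfolding upper_minkowski_content_def lower_minkowski_content_def minkowski_dim_eq
    by (auto intro: Limsup_eq Liminf_eq)
qed

lemma nonlattice_content:
  assumes "\<not> lattice_ifs N r"
  shows "has_minkowski_content F (ereal average)"
proof -
  have "(R.f \<longlongrightarrow> average) at_top"
  proof (rule R.nonlattice_tendsto)
    fix \<eta> :: real assume "\<eta> > 0"
    then obtain u v where "u \<in> semigroup_hull ((\<lambda>j. - ln (r j)) ` {1..N})"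
      "v \<in> semigroup_hull ((\<lambda>j. - ln (r j)) ` {1..N})" "0 < u - v" "u - v < \<eta>"
      using not_lattice_ifs_imp[OF assms] by metis
    then show "\<exists>u\<in>semigroup_hull (R.s ` {1..N}). \<exists>v\<in>semigroup_hull (R.s ` {1..N}).
        0 < u - v \<and> u - v < \<eta>"
      unfolding R.s_def by blast
  qed
  then have "(rescaled \<longlongrightarrow> average + 2 * 0) at_top"
    unfolding rescaled_def[abs_def] by (intro tendsto_intros R.exp_tendsto_0)
  then have "((\<lambda>\<epsilon>. rescaled (- ln \<epsilon>)) \<longlongrightarrow> average) (at_right 0)"
    using filterlim_compose[OF _ filterlim_minus_ln_at_right_0] by force
  then have "((\<lambda>\<epsilon>. ereal (rescaled (- ln \<epsilon>))) \<longlongrightarrow> ereal average) (at_right 0)"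
    by (rule tendsto_ereal)
  then show ?thesis
    unfolding has_minkowski_content_def contents_eq
    by (simp add: lim_imp_Liminf lim_imp_Limsup)
qed

lemma content_bounds: "0 < lower_minkowski_content F" "upper_minkowski_content F < \<infinity>"
proof -
  obtain k C where kC: "k > 0" "eventually (\<lambda>t. k \<le> rescaled t \<and> rescaled t \<le> C) at_top"
    by (rule rescaled_bounds)
  have ev: "eventually (\<lambda>\<epsilon>. k \<le> rescaled (- ln \<epsilon>) \<and> rescaled (- ln \<epsilon>) \<le> C) (at_right 0)"
    using eventually_compose_filterlim[OF kC(2) filterlim_minus_ln_at_right_0] .
  have "ereal k \<le> lower_minkowski_content F"
    unfolding contents_eq using ev by (intro Liminf_bounded) (auto elim: eventually_mono)
  moreover have "0 < ereal k" using kC(1) by simp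
  ultimately show "0 < lower_minkowski_content F" by (rule less_le_trans[rotated])
  have "upper_minkowski_content F \<le> ereal C"
    unfolding contents_eq using ev by (intro Limsup_bounded) (auto elim: eventually_mono)
  then show "upper_minkowski_content F < \<infinity>"
    by (rule le_less_trans) simp
qed

text \<open>If both contents agreed, their common value would be finite by
  \<open>content_bounds\<close>. Then \<open>rescaled\<close>, and with it \<open>R.f\<close>, would
  converge, which the lattice property excludes.\<close>

lemma lattice_content:
  assumes "lattice_ifs N r"
  shows "lower_minkowski_content F < upper_minkowski_content F"
proof -
  have "lower_minkowski_content F \<le> upper_minkowski_content F"
    unfolding contents_eq by (intro Liminf_le_Limsup) auto
  moreover have "lower_minkowski_content F \<noteq> upper_minkowski_content F"
  proof
    assume eq: "lower_minkowski_content F = upper_minkowski_content F"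
    have "0 < upper_minkowski_content F" "upper_minkowski_content F < \<infinity>"
      using content_bounds eq by simp_all
    then obtain m where m: "upper_minkowski_content F = ereal m"
      by (cases "upper_minkowski_content F") auto
    have "((\<lambda>\<epsilon>. ereal (rescaled (- ln \<epsilon>))) \<longlongrightarrow> ereal m) (at_right 0)"
      using m eq unfolding contents_eq by (intro Liminf_eq_Limsup) auto
    then have "((\<lambda>\<epsilon>. rescaled (- ln \<epsilon>)) \<longlongrightarrow> m) (at_right 0)"
      by simp
    from filterlim_compose[OF this filterlim_exp_minus_at_top]
    have "(rescaled \<longlongrightarrow> m) at_top" by simp
    then have "((\<lambda>t. rescaled t - 2 * exp (- \<delta> * t)) \<longlongrightarrow> m - 2 * 0) at_top"
      by (intro tendsto_intros R.exp_tendsto_0)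
    then have "(R.f \<longlongrightarrow> m) at_top" by (simp add: rescaled_def)
    moreover obtain a k where "a > 0" "\<And>j. j \<in> {1..N} \<Longrightarrow> k j \<ge> 1 \<and> - ln (r j) = real (k j) * a"
      using lattice_ifs_imp[OF assms] N_ge r_bounds by (metis One_nat_def Suc_leD numeral_2_eq_2)
    ultimately show False
      using R.lattice_not_convergent[of a k m] by (simp add: R.s_def)
  qed
  ultimately show ?thesis by simp
qed

end

theorem corollary2p12:
  fixes X F :: "real set" and N :: nat and \<phi> :: "nat \<Rightarrow> real \<Rightarrow> real" and r :: "nat \<Rightarrow> real"
    and \<delta> :: real
  assumes "similarity_ifs X N \<phi> r"
    and "self_similar_set X N \<phi> F"
    and "feasible_open_set N \<phi> (interior X)"
    and "emeasure lborel F = 0"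
    and "\<delta> = minkowski_dim F"
  shows "has_average_minkowski_content F
           (2 powr (1 - \<delta>) * (\<Sum>L\<in>primary_gaps N \<phi> F. measure lborel L powr \<delta>) /
             ((\<delta> - 1) * \<delta> * (\<Sum>i\<in>{1..N}. ln (r i) * r i powr \<delta>)))
       \<and> (\<not> lattice_ifs N r \<longrightarrow>
           has_minkowski_content F (ereal (average_minkowski_content F)))
       \<and> (lattice_ifs N r \<longrightarrow>
           0 < lower_minkowski_content F \<and>
           lower_minkowski_content F < upper_minkowski_content F \<and>
           upper_minkowski_content F < \<infinity>)"
proof -
  interpret interval_ifs X F N \<phi> r
    using assms by unfold_locales
  \<comment> \<open>The exponent is first produced from the Moran equation alone and only then
    identified with the dimension.\<close>
  obtain \<delta>' where "0 < \<delta>'" "\<delta>' < 1" "(\<Sum>i\<in>{1..N}. r i powr \<delta>') = 1"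
    by (rule moran_exponent)
  then interpret interval_ifs_moran X F N \<phi> r \<delta>'
    by unfold_locales
  have \<delta>: "\<delta> = \<delta>'" using assms(5) minkowski_dim_eq by simp
  show ?thesis
    unfolding \<delta> average_eq[symmetric]
    using average_content nonlattice_content[folded average_minkowski_content_eq]
      lattice_content content_bounds by blast
qed

end
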